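(* Let $1\le k<N$ be integers, $R>0$, and let $b\in C([0,R])\cap C^1(0,R)$. Assume that there exists $r_0\in[0,R]$ such that $$(r-r_0)\,(rb(r))'\ge0\quad\text{for }r\in(0,R).$$ Define $R_0\in(0,R]$ by $R_0=R$ if $rb(r)<k$ for every $r\in(0,R)$, and $R_0=\inf\{r\in(0,R): rb(r)=k\}$ otherwise. Consider the problem $$\mathcal P_k^+(D^2u)+b(|x|)|Du|=-1\ \text{ in }B_R,\qquad u=0\ \text{ on }\partial B_R.\qquad(\ast)$$ If $$\int^{R_0}\frac{r}{k-rb(r)}\,dr<+\infty,$$ then $R_0=R$ and problem $(\ast)$ has a unique solution, which is radial. On the other hand, if $$\int^{R_0}\frac{r}{k-rb(r)}\,dr=+\infty,$$ then no supersolutions of $(\ast)$ exist in $B_{R_0}$, i.e. there is no real-valued lower semicontinuous function $u$ on $\overline{B_{R_0}}$ with $u\ge0$ on $\partial B_{R_0}$ and $\mathcal P_k^+(D^2u)+b(|x|)|Du|\le-1$ in $B_{R_0}$.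
   Context: $B_\rho\subset\mathbb R^N$ is the open ball of radius $\rho$ centered at the origin. For a symmetric $N\times N$ matrix $X$ with ordered eigenvalues $\lambda_1(X)\le\dots\le\lambda_N(X)$, $\mathcal P_k^+(X)=\sum_{i=1}^k\lambda_{N+1-i}(X)$. The notation $\int^{R_0}$ refers to convergence or divergence of the (improper) integral at the upper endpoint $R_0$, i.e. of the integral over $(c,R_0)$ for $c\in(0,R_0)$; note $k-rb(r)>0$ on $[0,R_0)$. Equations and inequalities are in the viscosity sense: an upper (resp. lower) semicontinuous $u$ is a sub- (resp. super-)solution of the equation if whenever $\varphi$ is $C^2$ near an interior point $x_0$ and $u-\varphi$ has a local maximum (resp. minimum) at $x_0$, then $\mathcal P_k^+(D^2\varphi(x_0))+b(|x_0|)|D\varphi(x_0)|\ge-1$ (resp. $\le-1$). A solution of $(\ast)$ is $u\in C(\overline{B_R})$ that is both and vanishes on $\partial B_R$. *)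

theory Defs
  imports "HOL-Analysis.Analysis" "HOL-Computational_Algebra.Polynomial"
begin

definition charpoly :: "real^'n^'n \<Rightarrow> real poly" where
  "charpoly A = det (mat [:0, 1:] - map_matrix (\<lambda>a. [:a:]) A)"

lemma poly_charpoly: "poly (charpoly A) t = det (mat t - A)"
  unfolding charpoly_def det_def
  by (auto simp: poly_sum poly_prod mat_def of_int_poly intro!: sum.cong prod.cong)

(* The i-th eigenvalue in increasing order, 1 <= i <= CARD('n), counted with
   multiplicity. For symmetric A the list has length CARD('n); other
   matrices are irrelevant here. *)
definition ordered_eigenvalue :: "nat \<Rightarrow> real^'n^'n \<Rightarrow> real" where
  "ordered_eigenvalue i A = sorted_list_of_multiset (proots (charpoly A)) ! (i - 1)"

definition P_plus :: "nat \<Rightarrow> real^'n^'n \<Rightarrow> real" where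
  "P_plus k X = (\<Sum>i = 1..k. ordered_eigenvalue (CARD('n) + 1 - i) X)"

definition gradient :: "(real^'n \<Rightarrow> real) \<Rightarrow> real^'n \<Rightarrow> real^'n" where
  "gradient \<phi> x = (\<chi> i. frechet_derivative \<phi> (at x) (axis i 1))"

definition hessian :: "(real^'n \<Rightarrow> real) \<Rightarrow> real^'n \<Rightarrow> real^'n^'n" where
  "hessian \<phi> x = jacobian (gradient \<phi>) (at x)"

definition C2_near :: "(real^'n \<Rightarrow> real) \<Rightarrow> real^'n \<Rightarrow> bool" where
  "C2_near \<phi> x0 \<longleftrightarrow> (\<exists>U. open U \<and> x0 \<in> U \<and> \<phi> differentiable_on U \<and>
     gradient \<phi> differentiable_on U \<and> continuous_on U (hessian \<phi>))"

definition usc_on :: "'a::topological_space set \<Rightarrow> ('a \<Rightarrow> real) \<Rightarrow> bool" where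
  "usc_on S u \<longleftrightarrow> (\<forall>x\<in>S. \<forall>a. u x < a \<longrightarrow> (\<forall>\<^sub>F y in at x within S. u y < a))"

definition lsc_on :: "'a::topological_space set \<Rightarrow> ('a \<Rightarrow> real) \<Rightarrow> bool" where
  "lsc_on S u \<longleftrightarrow> (\<forall>x\<in>S. \<forall>a. a < u x \<longrightarrow> (\<forall>\<^sub>F y in at x within S. a < u y))"

definition local_max_at :: "('a::topological_space \<Rightarrow> real) \<Rightarrow> 'a \<Rightarrow> bool" where
  "local_max_at f x0 \<longleftrightarrow> (\<forall>\<^sub>F y in nhds x0. f y \<le> f x0)"

definition local_min_at :: "('a::topological_space \<Rightarrow> real) \<Rightarrow> 'a \<Rightarrow> bool" where
  "local_min_at f x0 \<longleftrightarrow> (\<forall>\<^sub>F y in nhds x0. f x0 \<le> f y)"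

(* In the next two definitions \<Omega> is meant to be open, so that a local extremum
   at x0 \<in> \<Omega> does not depend on the values of u outside \<Omega>. *)
definition visc_subsolution ::
    "nat \<Rightarrow> (real \<Rightarrow> real) \<Rightarrow> (real^'n) set \<Rightarrow> (real^'n \<Rightarrow> real) \<Rightarrow> bool" where
  "visc_subsolution k b \<Omega> u \<longleftrightarrow> usc_on \<Omega> u \<and>
     (\<forall>x0\<in>\<Omega>. \<forall>\<phi>. C2_near \<phi> x0 \<and> local_max_at (\<lambda>y. u y - \<phi> y) x0 \<longrightarrow>
        P_plus k (hessian \<phi> x0) + b (norm x0) * norm (gradient \<phi> x0) \<ge> -1)"

definition visc_supersolution ::
    "nat \<Rightarrow> (real \<Rightarrow> real) \<Rightarrow> (real^'n) set \<Rightarrow> (real^'n \<Rightarrow> real) \<Rightarrow> bool" where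
  "visc_supersolution k b \<Omega> u \<longleftrightarrow> lsc_on \<Omega> u \<and>
     (\<forall>x0\<in>\<Omega>. \<forall>\<phi>. C2_near \<phi> x0 \<and> local_min_at (\<lambda>y. u y - \<phi> y) x0 \<longrightarrow>
        P_plus k (hessian \<phi> x0) + b (norm x0) * norm (gradient \<phi> x0) \<le> -1)"

(* Only the values of u on the closed ball matter. *)
definition dirichlet_solution ::
    "nat \<Rightarrow> (real \<Rightarrow> real) \<Rightarrow> real \<Rightarrow> (real^'n \<Rightarrow> real) \<Rightarrow> bool" where
  "dirichlet_solution k b R u \<longleftrightarrow> continuous_on (cball 0 R) u \<and>
     visc_subsolution k b (ball 0 R) u \<and> visc_supersolution k b (ball 0 R) u \<and>
     (\<forall>x\<in>sphere 0 R. u x = 0)"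

definition dirichlet_supersolution ::
    "nat \<Rightarrow> (real \<Rightarrow> real) \<Rightarrow> real \<Rightarrow> (real^'n \<Rightarrow> real) \<Rightarrow> bool" where
  "dirichlet_supersolution k b R u \<longleftrightarrow> lsc_on (cball 0 R) u \<and>
     visc_supersolution k b (ball 0 R) u \<and> (\<forall>x\<in>sphere 0 R. u x \<ge> 0)"

definition radial_on :: "(real^'n) set \<Rightarrow> (real^'n \<Rightarrow> real) \<Rightarrow> bool" where
  "radial_on S u \<longleftrightarrow> (\<exists>g. \<forall>x\<in>S. u x = g (norm x))"

definition critical_radius :: "nat \<Rightarrow> (real \<Rightarrow> real) \<Rightarrow> real \<Rightarrow> real" where
  "critical_radius k b R =
     (if \<forall>r\<in>{0<..<R}. r * b r < real k then R
      else Inf {r \<in> {0<..<R}. r * b r = real k})"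

(* The integrand is continuous and positive on (c, \<rho>) for \<rho> the critical radius,
   so the improper integral at \<rho> is the Lebesgue integral of a nonnegative function. *)
definition endpoint_integral :: "nat \<Rightarrow> (real \<Rightarrow> real) \<Rightarrow> real \<Rightarrow> real \<Rightarrow> ennreal" where
  "endpoint_integral k b c \<rho> =
     (\<integral>\<^sup>+ r \<in> {c<..<\<rho>}. ennreal (r / (real k - r * b r)) \<partial>lborel)"

end

theory Submission
  imports Defs
begin

text \<open>
  A decreasing radial function \<open>u\<close> with \<open>u'(r) = - r w(r)\<close> solves the equation iff
  \<open>(k - r b) w = 1 + r (w')\<^sup>-\<close>, because \<open>D\<^sup>2u\<close> has the eigenvalues \<open>- w\<close> (\<open>N - 1\<close> times,
  and \<open>k < N\<close>) and \<open>- w - r w'\<close>. Under the monotonicity assumption on \<open>r b(r)\<close> the solution is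
  \<open>w = max W g\<close>, where \<open>g = 1 / (k - r b)\<close> and \<open>W\<close> solves the linear equation
  \<open>(k - r b) W = 1 - r W'\<close>, \<open>W(0) = 1/k\<close>: if \<open>M\<close> is the integrating factor of the latter, then
  \<open>(M (W - g))' = - M g'\<close>, so \<open>W \<ge> g\<close> up to some radius and \<open>w = g\<close> beyond it. Although \<open>u\<close>
  need not be \<open>C\<^sup>2\<close> where \<open>W = g\<close>, at every point it is touched from either side by quadratic
  polynomials in \<open>|x|\<^sup>2\<close> that satisfy the required inequality up to an arbitrarily small error.
  The operator is positively 1-homogeneous, so \<open>(1 \<plusminus> \<epsilon>) u\<close> are strict super- and subsolutions
  touched by smooth functions, and comparison with them needs no doubling of variables. If the
  integral diverges, comparison on smaller balls forces a supersolution to be infinite at \<open>0\<close>.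
\<close>

subsection \<open>Spectral theorem and Ky Fan's principle\<close>

text \<open>The negative part in the equation for \<open>w\<close> appears because the top
  \<open>k\<close> of \<open>N > k\<close> eigenvalues can avoid the radial one when it is the
  smallest. Where \<open>w\<close> increases the equation is therefore algebraic and forces
  \<open>w = g\<close>; where it decreases the linear equation holds. The hypothesis on
  \<open>r b(r)\<close> makes \<open>g\<close> fall before \<open>r0\<close> and rise after it,
  which is why one switch suffices. The touching polynomials are taken in |x|^2, not in |x|, so that
  they remain smooth at the origin. The factors 1 \<plusminus> \<epsilon> respect the zero boundary
  values, so strict comparison works on the whole ball. Since
  \<open>g \<le> w \<le> g + sup |W|\<close> with \<open>W\<close> bounded, the profile is bounded
  exactly when the integral converges. The two possible endpoints differ: at an interior zero
  \<open>r b(r)\<close> is differentiable, so \<open>k - r b(r)\<close> vanishes at least linearly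
  and the integral diverges; at \<open>R\<close> only continuity is known and the integral may
  converge. This is how a finite integral yields \<open>R0 = R\<close>.\<close>

lemma symmetric_matrix_dot:
  fixes A :: "real^'n^'n"
  assumes "transpose A = A"
  shows "(A *v x) \<bullet> y = x \<bullet> (A *v y)"
  using assms by (metis dot_lmul_matrix transpose_matrix_vector)

text \<open>A maximiser of the Rayleigh quotient on the unit sphere of \<open>V\<close> works:
  moving from it along the residual \<open>e = A *v x - l x\<close>, which lies in \<open>V\<close>
  by invariance, would increase the quotient to first order unless \<open>e = 0\<close>.\<close>

lemma symmetric_matrix_eigenvector_in_subspace:
  fixes A :: "real^'n^'n"
  assumes sym: "transpose A = A" and V: "subspace V" and y: "y \<in> V" "y \<noteq> 0"
    and inv: "\<And>x. x \<in> V \<Longrightarrow> A *v x \<in> V"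
  obtains x l where "x \<in> V" "norm x = 1" "A *v x = l *\<^sub>R x"
proof -
  let ?S = "V \<inter> sphere 0 1"
  have comp: "compact ?S"
    using closed_subspace[OF V] by (simp add: closed_Int_compact)
  have "y /\<^sub>R norm y \<in> ?S"
    using y V by (auto simp: subspace_scale)
  then have ne: "?S \<noteq> {}" by blast
  have "continuous_on ?S (\<lambda>x. x \<bullet> (A *v x))"
    by (intro continuous_intros)
  from continuous_attains_sup[OF comp ne this] obtain x where
    x: "x \<in> V" "norm x = 1" and max: "\<And>z. z \<in> V \<Longrightarrow> norm z = 1 \<Longrightarrow> z \<bullet> (A *v z) \<le> x \<bullet> (A *v x)"
    by auto
  define l where "l = x \<bullet> (A *v x)"
  have quad: "z \<bullet> (A *v z) \<le> l * (z \<bullet> z)" if "z \<in> V" for z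
  proof (cases "z = 0")
    case False
    have "(z /\<^sub>R norm z) \<bullet> (A *v (z /\<^sub>R norm z)) \<le> l"
      unfolding l_def using max[of "z /\<^sub>R norm z"] that V False by (auto simp: subspace_scale)
    then have "(z \<bullet> (A *v z)) / (norm z)^2 \<le> l"
      by (simp add: matrix_vector_mult_scaleR power2_eq_square divide_simps)
    then show ?thesis
      using False by (simp add: divide_simps dot_square_norm)
  qed auto
  define e where "e = A *v x - l *\<^sub>R x"
  have eV: "e \<in> V"
    unfolding e_def using x inv V by (simp add: subspace_diff subspace_scale)
  define K where "K = e \<bullet> (A *v e) - l * (e \<bullet> e)"
  have ee: "e \<bullet> (A *v x) - l * (e \<bullet> x) = e \<bullet> e"
    unfolding e_def by (simp add: inner_diff_right inner_diff_left algebra_simps)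
  have xx: "x \<bullet> x = 1" using x(2) by (simp add: norm_eq_1)
  have main: "2 * t * (e \<bullet> e) + t^2 * K \<le> 0" for t
  proof -
    have "(x + t *\<^sub>R e) \<bullet> (A *v (x + t *\<^sub>R e)) \<le> l * ((x + t *\<^sub>R e) \<bullet> (x + t *\<^sub>R e))"
      by (rule quad) (use x eV V in \<open>auto simp: subspace_add subspace_scale\<close>)
    moreover have "x \<bullet> (A *v e) = e \<bullet> (A *v x)"
      using symmetric_matrix_dot[OF sym, of x e] by (simp add: inner_commute)
    ultimately have "l + 2 * t * (e \<bullet> (A *v x)) + t^2 * (e \<bullet> (A *v e))
        \<le> l * (1 + 2 * t * (e \<bullet> x) + t^2 * (e \<bullet> e))"
      using xx l_def
      by (simp add: matrix_vector_mult_scaleR matrix_vector_right_distrib inner_add_left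
          inner_add_right power2_eq_square algebra_simps inner_commute)
    then show ?thesis
      unfolding K_def ee[symmetric] by (simp add: algebra_simps)
  qed
  have "e \<bullet> e \<le> 0"
  proof (rule ccontr)
    assume "\<not> e \<bullet> e \<le> 0"
    then have pos: "e \<bullet> e > 0" by linarith
    \<comment> \<open>Small enough that \<open>t * K\<close> is at most \<open>e \<bullet> e\<close>
      in absolute value and cannot outweigh the first-order term
      \<open>2 * (e \<bullet> e)\<close>.\<close>
    define t where "t = (e \<bullet> e) / (\<bar>K\<bar> + 1)"
    have t: "t > 0" unfolding t_def using pos by simp
    have "t * (2 * (e \<bullet> e) + t * K) \<le> 0"
      using main[of t] by (simp add: power2_eq_square algebra_simps)
    then have "2 * (e \<bullet> e) + t * K \<le> 0"
      using t by (simp add: mult_le_0_iff)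
    moreover have "t * \<bar>K\<bar> \<le> e \<bullet> e"
    proof -
      have "t * \<bar>K\<bar> \<le> t * (\<bar>K\<bar> + 1)" using t by simp
      also have "\<dots> = e \<bullet> e" unfolding t_def by simp
      finally show ?thesis .
    qed
    moreover have "- (t * \<bar>K\<bar>) \<le> t * K"
      using t by (metis abs_ge_minus_self abs_mult abs_of_pos minus_le_iff)
    ultimately show False using pos by linarith
  qed
  then have "e = 0" by (metis inner_eq_zero_iff inner_ge_zero order_antisym)
  then show ?thesis using that[of x l] x unfolding e_def by simp
qed

text \<open>Eigenvectors are collected one at a time: the orthogonal complement of those already
  found is invariant because \<open>A\<close> is symmetric, and contains another one.\<close>

lemma symmetric_matrix_orthonormal_eigenvectors:
  fixes A :: "real^'n^'n"
  assumes sym: "transpose A = A"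
  obtains Q :: "'n \<Rightarrow> real^'n" and ev :: "'n \<Rightarrow> real"
  where "\<And>i j. Q i \<bullet> Q j = (if i = j then 1 else 0)" "\<And>i. A *v Q i = ev i *\<^sub>R Q i"
proof -
  have "\<exists>B. finite B \<and> card B = m \<and> pairwise orthogonal B \<and>
      (\<forall>x\<in>B. norm x = 1 \<and> (\<exists>l. A *v x = l *\<^sub>R x))" if "m \<le> CARD('n)" for m
    using that
  proof (induction m)
    case 0
    then show ?case by (intro exI[of _ "{}"]) auto
  next
    case (Suc m)
    then obtain B where B: "finite B" "card B = m" "pairwise orthogonal B"
      "\<forall>x\<in>B. norm x = 1 \<and> (\<exists>l. A *v x = l *\<^sub>R x)" by auto
    define V where "V = {y. \<forall>x\<in>B. orthogonal x y}"
    have V: "subspace V"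
      unfolding V_def subspace_def by (auto simp: orthogonal_def inner_add_right)
    have "dim B < DIM(real^'n)"
      using dim_le_card[OF span_superset B(1)] B(2) Suc.prems by simp
    from orthogonal_to_subspace_exists[OF this] obtain y where
      y: "y \<noteq> 0" "\<And>x. x \<in> span B \<Longrightarrow> orthogonal y x" by blast
    have yV: "y \<in> V"
      unfolding V_def using y(2) by (auto simp: orthogonal_commute span_base)
    have inv: "A *v x \<in> V" if "x \<in> V" for x
      unfolding V_def
    proof clarsimp
      fix z assume z: "z \<in> B"
      then obtain l where "A *v z = l *\<^sub>R z" using B by blast
      then have "z \<bullet> (A *v x) = l * (z \<bullet> x)"
        using symmetric_matrix_dot[OF sym, of z x] by simp
      then show "orthogonal z (A *v x)"
        using that z unfolding V_def by (simp add: orthogonal_def)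
    qed
    obtain x l where x: "x \<in> V" "norm x = 1" "A *v x = l *\<^sub>R x"
      using symmetric_matrix_eigenvector_in_subspace[OF sym V yV y(1) inv] by blast
    have "x \<notin> B"
      using x(1,2) unfolding V_def by (auto simp: orthogonal_def norm_eq_1)
    then show ?case
      using B x unfolding V_def
      by (intro exI[of _ "insert x B"]) (auto simp: pairwise_insert orthogonal_commute)
  qed
  from this[of "CARD('n)"] obtain B where B: "finite B" "card B = CARD('n)" "pairwise orthogonal B"
      "\<forall>x\<in>B. norm x = 1 \<and> (\<exists>l. A *v x = l *\<^sub>R x)" by auto
  obtain Q where Q: "bij_betw Q (UNIV :: 'n set) B"
    using finite_same_card_bij[of "UNIV :: 'n set" B] B by auto
  have QB: "Q i \<in> B" for i using Q by (auto simp: bij_betw_def)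
  have "\<exists>l. A *v Q i = l *\<^sub>R Q i" for i using B(4) QB by blast
  then obtain ev where "\<And>i. A *v Q i = ev i *\<^sub>R Q i" by metis
  moreover have "Q i \<bullet> Q j = (if i = j then 1 else 0)" for i j
  proof (cases "i = j")
    case True
    then show ?thesis using B(4) QB[of j] by (simp add: norm_eq_1)
  next
    case False
    then have "Q i \<noteq> Q j" using Q by (auto simp: bij_betw_def inj_on_def)
    then show ?thesis using B(3) QB False by (auto simp: pairwise_def orthogonal_def)
  qed
  ultimately show ?thesis using that by blast
qed


text \<open>Links the roots used in \<open>ordered_eigenvalue\<close>, with multiplicity, to an
  orthonormal eigenbasis. With the basis as columns of \<open>M\<close>,
  \<open>(mat t - A) ** M = M ** D\<close> for a diagonal \<open>D\<close>, and \<open>det M\<close>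
  cancels.\<close>

lemma proots_charpoly_of_eigenbasis:
  fixes A :: "real^'n^'n" and Q :: "'n \<Rightarrow> real^'n"
  assumes orth: "\<And>i j. Q i \<bullet> Q j = (if i = j then 1 else 0)"
    and ev: "\<And>i. A *v Q i = ev i *\<^sub>R Q i"
  shows "proots (charpoly A) = image_mset ev (mset_set UNIV)"
proof -
  define M :: "real^'n^'n" where "M = (\<chi> i j. Q j $ i)"
  have col: "column j M = Q j" for j
    by (simp add: M_def column_def vec_eq_iff)
  have "orthogonal_matrix M"
    by (auto simp: orthogonal_matrix_orthonormal_columns col norm_eq_1 orth orthogonal_def)
  then have detM: "det M \<noteq> 0"
    using det_orthogonal_matrix by fastforce
  have "det (mat t - A) = (\<Prod>i\<in>UNIV. t - ev i)" for t
  proof -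
    define D :: "real^'n^'n" where "D = (\<chi> i j. if i = j then t - ev i else 0)"
    have "(mat t - A) ** M = M ** D"
    proof -
      have "((mat t - A) ** M) $ i $ j = (M ** D) $ i $ j" for i j
      proof -
        have "((mat t - A) ** M) $ i $ j = ((mat t - A) *v Q j) $ i"
          by (simp add: matrix_matrix_mult_def matrix_vector_mult_def M_def)
        also have "(mat t - A) *v Q j = (t - ev j) *\<^sub>R Q j"
        proof -
          have "mat t *v Q j = t *\<^sub>R Q j"
            by (simp add: vec_eq_iff matrix_vector_mult_def mat_def if_distrib[where f = "\<lambda>x. x * _"] cong: if_cong)
          then show ?thesis
            by (simp add: matrix_vector_mult_diff_rdistrib ev scaleR_left_diff_distrib)
        qed
        also have "((t - ev j) *\<^sub>R Q j) $ i = (M ** D) $ i $ j"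
          by (simp add: matrix_matrix_mult_def M_def D_def if_distrib[where f = "\<lambda>x. _ * x"] cong: if_cong)
        finally show ?thesis .
      qed
      then show ?thesis by (simp add: vec_eq_iff)
    qed
    then have "det (mat t - A) * det M = det M * det D"
      by (metis det_mul)
    moreover have "det D = (\<Prod>i\<in>UNIV. t - ev i)"
      unfolding D_def by (subst det_diagonal) auto
    ultimately show ?thesis using detM by simp
  qed
  then have "poly (charpoly A) = poly (\<Prod>i\<in>UNIV. [:- ev i, 1:])"
    by (auto simp: fun_eq_iff poly_charpoly poly_prod)
  then have "charpoly A = (\<Prod>i\<in>UNIV. [:- ev i, 1:])"
    by (simp add: poly_eq_poly_eq_iff)
  then show ?thesis
    by (simp add: proots_prod sum_unfold_sum_mset)
qed


text \<open>Bessel's inequality: \<open>q - p\<close> has nonnegative square, where \<open>p\<close>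
  is the projection of \<open>q\<close> onto the span of \<open>F\<close>.\<close>

lemma sum_inner_orthonormal_squares_le:
  fixes q :: "'a::real_inner"
  assumes "finite F" "pairwise orthogonal F" "\<And>f. f \<in> F \<Longrightarrow> norm f = 1"
  shows "(\<Sum>f\<in>F. (f \<bullet> q)\<^sup>2) \<le> q \<bullet> q"
proof -
  define p where "p = (\<Sum>f\<in>F. (f \<bullet> q) *\<^sub>R f)"
  have fp: "f \<bullet> p = f \<bullet> q" if "f \<in> F" for f
  proof -
    have "f \<bullet> p = (\<Sum>g\<in>F. (g \<bullet> q) * (f \<bullet> g))"
      unfolding p_def by (simp add: inner_sum_right)
    also have "\<dots> = (\<Sum>g\<in>F. if g = f then f \<bullet> q else 0)"
    proof (rule sum.cong[OF refl])
      fix g assume "g \<in> F"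
      show "(g \<bullet> q) * (f \<bullet> g) = (if g = f then f \<bullet> q else 0)"
      proof (cases "g = f")
        case True
        then show ?thesis using assms(3)[OF that] by (simp add: norm_eq_1)
      next
        case False
        then have "f \<bullet> g = 0"
          using assms(2) that \<open>g \<in> F\<close> by (auto simp: pairwise_def orthogonal_def)
        then show ?thesis using False by simp
      qed
    qed
    also have "\<dots> = f \<bullet> q" using that assms(1) by simp
    finally show ?thesis .
  qed
  have "p \<bullet> p = (\<Sum>f\<in>F. (f \<bullet> q) * (f \<bullet> p))"
    by (subst p_def) (simp add: inner_sum_left)
  then have pp: "p \<bullet> p = (\<Sum>f\<in>F. (f \<bullet> q)\<^sup>2)"
    by (simp add: fp power2_eq_square)
  have qp: "q \<bullet> p = (\<Sum>f\<in>F. (f \<bullet> q)\<^sup>2)"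
    unfolding p_def by (simp add: inner_sum_right power2_eq_square inner_commute)
  have "0 \<le> (q - p) \<bullet> (q - p)" by simp
  also have "\<dots> = q \<bullet> q - 2 * (q \<bullet> p) + p \<bullet> p"
    by (simp add: inner_diff_left inner_diff_right inner_commute)
  finally show ?thesis using pp qp by simp
qed

text \<open>Sorting the eigenbasis by eigenvalue turns \<open>P_plus\<close> into a sum over a final
  segment of indices, the form in which Ky Fan's principle is proved.\<close>

lemma P_plus_eigenbasis:
  fixes A :: "real^'n^'n"
  assumes sym: "transpose A = A"
  obtains Q :: "nat \<Rightarrow> real^'n" and ev :: "nat \<Rightarrow> real" where
    "\<And>i j. i < CARD('n) \<Longrightarrow> j < CARD('n) \<Longrightarrow> Q i \<bullet> Q j = (if i = j then 1 else 0)"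
    "\<And>i. i < CARD('n) \<Longrightarrow> A *v Q i = ev i *\<^sub>R Q i"
    "\<And>i j. i \<le> j \<Longrightarrow> j < CARD('n) \<Longrightarrow> ev i \<le> ev j"
    "\<And>k. k \<le> CARD('n) \<Longrightarrow> P_plus k A = (\<Sum>i\<in>{CARD('n) - k..<CARD('n)}. ev i)"
proof -
  let ?N = "CARD('n)"
  obtain Q :: "'n \<Rightarrow> real^'n" and ev :: "'n \<Rightarrow> real"
    where Q: "\<And>i j. Q i \<bullet> Q j = (if i = j then 1 else 0)" "\<And>i. A *v Q i = ev i *\<^sub>R Q i"
    using symmetric_matrix_orthonormal_eigenvectors[OF sym] by blast
  obtain xs :: "'n list" where xs: "set xs = UNIV" "distinct xs"
    using finite_distinct_list[of "UNIV :: 'n set"] by auto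
  define ys where "ys = sort_key ev xs"
  have ys: "set ys = UNIV" "distinct ys" "length ys = ?N" "sorted (map ev ys)"
    unfolding ys_def using xs distinct_card[of xs] by auto
  have "mset (map ev ys) = proots (charpoly A)"
    unfolding proots_charpoly_of_eigenbasis[OF Q] using ys by (metis mset_map mset_set_set)
  then have "sorted_list_of_multiset (proots (charpoly A)) = map ev ys"
    using ys(4) by (metis sorted_list_of_multiset_mset sorted_sort_id)
  then have P: "P_plus k A = (\<Sum>i = 1..k. map ev ys ! (?N + 1 - i - 1))" for k
    unfolding P_plus_def ordered_eigenvalue_def by simp
  show ?thesis
  proof (rule that[of "\<lambda>i. Q (ys ! i)" "\<lambda>i. ev (ys ! i)"])
    fix i j assume "i < ?N" "j < ?N"
    then show "Q (ys ! i) \<bullet> Q (ys ! j) = (if i = j then 1 else 0)"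
      using ys(2,3) by (auto simp: Q nth_eq_iff_index_eq)
  next
    fix i show "A *v Q (ys ! i) = ev (ys ! i) *\<^sub>R Q (ys ! i)" by (simp add: Q)
  next
    fix i j assume "i \<le> j" "j < ?N"
    then show "ev (ys ! i) \<le> ev (ys ! j)"
      using ys(3,4) by (auto simp: sorted_iff_nth_mono)
  next
    fix k assume k: "k \<le> ?N"
    \<comment> \<open>List positions start at 0, so the eigenvalue numbered
      \<open>CARD('n) + 1 - i\<close> sits at position \<open>CARD('n) - i\<close>.\<close>
    show "P_plus k A = (\<Sum>i\<in>{?N - k..<?N}. ev (ys ! i))"
      unfolding P
      by (rule sum.reindex_bij_witness[of _ "\<lambda>i. ?N - i" "\<lambda>i. ?N - i"]) (use k ys(3) in auto)
  qed
qed

text \<open>Bathtub principle: weights in \<open>[0, 1]\<close> of total mass \<open>k\<close> are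
  best placed on the \<open>k\<close> largest values. After subtracting the threshold
  \<open>m\<close>, the lower terms are nonpositive and the upper ones nonnegative.\<close>

lemma sum_weighted_le_top:
  fixes ev c :: "nat \<Rightarrow> real"
  assumes mono: "\<And>i j. i \<le> j \<Longrightarrow> j < N \<Longrightarrow> ev i \<le> ev j"
    and c: "\<And>i. i < N \<Longrightarrow> 0 \<le> c i" "\<And>i. i < N \<Longrightarrow> c i \<le> 1" "(\<Sum>i<N. c i) = real k" and k: "k \<le> N"
  shows "(\<Sum>i<N. ev i * c i) \<le> (\<Sum>i\<in>{N - k..<N}. ev i)"
\<comment> \<open>For \<open>k = 0\<close> the threshold index \<open>N - k\<close> would fall
  outside the range on which \<open>ev\<close> is known to be monotone.\<close>
proof (cases "k = 0")
  case True
  then have "\<forall>i\<in>{..<N}. c i = 0"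
    using c sum_nonneg_eq_0_iff[of "{..<N}" c] by auto
  then show ?thesis using True by simp
next
  case False
  define m where "m = ev (N - k)"
  have split: "{..<N} = {..<N - k} \<union> {N - k..<N}" using k by auto
  have "(\<Sum>i<N. (ev i - m) * c i)
      = (\<Sum>i<N - k. (ev i - m) * c i) + (\<Sum>i\<in>{N - k..<N}. (ev i - m) * c i)"
    unfolding split by (rule sum.union_disjoint) auto
  also have "(\<Sum>i<N - k. (ev i - m) * c i) \<le> 0"
    by (rule sum_nonpos) (use mono[of _ "N - k"] c(1) False k in \<open>auto simp: m_def mult_le_0_iff\<close>)
  also have "(\<Sum>i\<in>{N - k..<N}. (ev i - m) * c i) \<le> (\<Sum>i\<in>{N - k..<N}. ev i - m)"
    by (rule sum_mono) (use mono[of "N - k"] c(1,2) in \<open>auto simp: m_def intro!: mult_left_le\<close>)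
  finally have "(\<Sum>i<N. (ev i - m) * c i) \<le> (\<Sum>i\<in>{N - k..<N}. ev i) - real k * m"
    using k by (simp add: sum_subtractf)
  moreover have "(\<Sum>i<N. (ev i - m) * c i) = (\<Sum>i<N. ev i * c i) - m * real k"
    by (simp add: left_diff_distrib sum_subtractf sum_distrib_left[symmetric] c(3))
  ultimately show ?thesis by (simp add: mult.commute)
qed

text \<open>Together with the next lemma this is Ky Fan's variational characterisation.\<close>

lemma sum_frame_le_P_plus:
  fixes A :: "real^'n^'n"
  assumes sym: "transpose A = A"
    and F: "finite F" "pairwise orthogonal F" "\<And>f. f \<in> F \<Longrightarrow> norm f = 1" "card F \<le> CARD('n)"
  shows "(\<Sum>f\<in>F. f \<bullet> (A *v f)) \<le> P_plus (card F) A"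
proof -
  let ?N = "CARD('n)"
  obtain Q :: "nat \<Rightarrow> real^'n" and ev where
    Q: "\<And>i j. i < ?N \<Longrightarrow> j < ?N \<Longrightarrow> Q i \<bullet> Q j = (if i = j then 1 else 0)"
    "\<And>i. i < ?N \<Longrightarrow> A *v Q i = ev i *\<^sub>R Q i"
    "\<And>i j. i \<le> j \<Longrightarrow> j < ?N \<Longrightarrow> ev i \<le> ev j"
    "\<And>k. k \<le> ?N \<Longrightarrow> P_plus k A = (\<Sum>i\<in>{?N - k..<?N}. ev i)"
    using P_plus_eigenbasis[OF sym] by blast
  have inj: "inj_on Q {..<?N}"
    using Q(1) by (intro inj_onI) (metis lessThan_iff zero_neq_one)
  let ?B = "Q ` {..<?N}"
  have B: "pairwise orthogonal ?B" "\<And>q. q \<in> ?B \<Longrightarrow> norm q = 1" "card ?B = ?N"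
    using Q(1) inj by (auto simp: pairwise_def orthogonal_def norm_eq_1 card_image)
  moreover have "0 \<notin> ?B" using B(2) by force
  ultimately have "independent ?B"
    by (intro pairwise_orthogonal_independent)
  then have span: "span ?B = UNIV"
    using card_ge_dim_independent[of ?B UNIV] B(3) by auto
  have expand: "x = (\<Sum>i<?N. (x \<bullet> Q i) *\<^sub>R Q i)" for x
    using orthonormal_basis_expand[of ?B x] B span by (simp add: sum.reindex[OF inj])
  have form: "x \<bullet> (A *v x) = (\<Sum>i<?N. ev i * (x \<bullet> Q i)\<^sup>2)" for x
  proof -
    have "A *v x = (\<Sum>i<?N. (x \<bullet> Q i) *\<^sub>R (A *v Q i))"
      by (subst expand) (simp add: linear_sum[OF matrix_vector_mul_linear] matrix_vector_mult_scaleR)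
    also have "\<dots> = (\<Sum>i<?N. ((x \<bullet> Q i) * ev i) *\<^sub>R Q i)"
      by (rule sum.cong) (auto simp: Q(2))
    finally show ?thesis by (simp add: inner_sum_right power2_eq_square mult_ac)
  qed
  have sq: "x \<bullet> x = (\<Sum>i<?N. (x \<bullet> Q i)\<^sup>2)" for x
  proof -
    have "x \<bullet> x = x \<bullet> (\<Sum>i<?N. (x \<bullet> Q i) *\<^sub>R Q i)" using expand[of x] by simp
    then show ?thesis by (simp add: inner_sum_right power2_eq_square)
  qed
  \<comment> \<open>\<open>c i\<close> is the weight that the frame puts on the i-th eigenvalue: at
    most 1 by Bessel, and \<open>card F\<close> in total because \<open>Q\<close> is an orthonormal
    basis and the frame vectors are unit vectors.\<close>
  define c where "c i = (\<Sum>f\<in>F. (f \<bullet> Q i)\<^sup>2)" for i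
  have "(\<Sum>f\<in>F. f \<bullet> (A *v f)) = (\<Sum>i<?N. ev i * c i)"
    unfolding form c_def sum_distrib_left by (rule sum.swap)
  also have "\<dots> \<le> (\<Sum>i\<in>{?N - card F..<?N}. ev i)"
  proof (rule sum_weighted_le_top[OF Q(3)])
    show "c i \<le> 1" if "i < ?N" for i
      unfolding c_def using sum_inner_orthonormal_squares_le[OF F(1-3), of "Q i"] Q(1)[OF that that]
      by simp
    have "(\<Sum>i<?N. c i) = (\<Sum>f\<in>F. f \<bullet> f)"
      unfolding sq c_def by (rule sum.swap)
    also have "\<dots> = real (card F)" using F(3) by (simp add: norm_eq_1)
    finally show "(\<Sum>i<?N. c i) = real (card F)" .
  qed (use F in \<open>auto simp: c_def sum_nonneg\<close>)
  finally show ?thesis using Q(4) F by simp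
qed

lemma P_plus_attained:
  fixes A :: "real^'n^'n"
  assumes sym: "transpose A = A" and k: "k \<le> CARD('n)"
  obtains F where "finite F" "pairwise orthogonal F" "\<forall>f\<in>F. norm f = 1" "card F = k"
    "P_plus k A = (\<Sum>f\<in>F. f \<bullet> (A *v f))"
proof -
  let ?N = "CARD('n)"
  obtain Q :: "nat \<Rightarrow> real^'n" and ev where
    Q: "\<And>i j. i < ?N \<Longrightarrow> j < ?N \<Longrightarrow> Q i \<bullet> Q j = (if i = j then 1 else 0)"
    "\<And>i. i < ?N \<Longrightarrow> A *v Q i = ev i *\<^sub>R Q i"
    "\<And>i j. i \<le> j \<Longrightarrow> j < ?N \<Longrightarrow> ev i \<le> ev j"
    "\<And>k. k \<le> ?N \<Longrightarrow> P_plus k A = (\<Sum>i\<in>{?N - k..<?N}. ev i)"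
    using P_plus_eigenbasis[OF sym] by blast
  have inj: "inj_on Q {?N - k..<?N}"
  proof (rule inj_onI)
    fix i j assume "i \<in> {?N - k..<?N}" "j \<in> {?N - k..<?N}" "Q i = Q j"
    then show "i = j" using Q(1)[of i j] Q(1)[of j j] by (auto split: if_splits)
  qed
  let ?F = "Q ` {?N - k..<?N}"
  have "(\<Sum>f\<in>?F. f \<bullet> (A *v f)) = (\<Sum>i\<in>{?N - k..<?N}. Q i \<bullet> (A *v Q i))"
    by (simp add: sum.reindex[OF inj])
  also have "\<dots> = P_plus k A"
    unfolding Q(4)[OF k] by (rule sum.cong) (simp_all add: Q(1,2))
  finally have P: "P_plus k A = (\<Sum>f\<in>?F. f \<bullet> (A *v f))" by simp
  have orth: "pairwise orthogonal ?F"
    unfolding pairwise_def orthogonal_def by (auto simp: Q(1))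
  have norm: "\<forall>f\<in>?F. norm f = 1"
    by (auto simp: Q(1) norm_eq_1)
  show ?thesis
    by (rule that[OF _ orth norm _ P]) (simp_all add: card_image[OF inj] k)
qed

text \<open>The quadratic form on the right is that of the Hessian at \<open>x\<close> of a function
  of \<open>x \<bullet> x\<close>.\<close>

lemma P_plus_le_radial:
  fixes A :: "real^'n^'n"
  assumes sym: "transpose A = A" and k: "k \<le> CARD('n)"
    and le: "\<And>v. v \<bullet> (A *v v) \<le> 2 * \<beta> * (v \<bullet> v) + 8 * \<gamma> * (x \<bullet> v)\<^sup>2"
  shows "P_plus k A \<le> 2 * \<beta> * real k + 8 * (norm x)\<^sup>2 * max \<gamma> 0"
proof -
  obtain F where F: "finite F" "pairwise orthogonal F" "\<forall>f\<in>F. norm f = 1" "card F = k"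
    "P_plus k A = (\<Sum>f\<in>F. f \<bullet> (A *v f))"
    by (rule P_plus_attained[OF sym k])
  have "P_plus k A \<le> (\<Sum>f\<in>F. 2 * \<beta> * (f \<bullet> f) + 8 * \<gamma> * (x \<bullet> f)\<^sup>2)"
    unfolding F(5) by (rule sum_mono) (rule le)
  also have "\<dots> = (\<Sum>f\<in>F. 2 * \<beta>) + (\<Sum>f\<in>F. 8 * \<gamma> * (f \<bullet> x)\<^sup>2)"
    unfolding sum.distrib[symmetric]
    by (rule sum.cong[OF refl]) (use F(3) in \<open>simp add: norm_eq_1 inner_commute[of x]\<close>)
  also have "\<dots> = 2 * \<beta> * real k + 8 * (\<gamma> * (\<Sum>f\<in>F. (f \<bullet> x)\<^sup>2))"
    by (simp add: F(4) sum_distrib_left mult.assoc)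
  \<comment> \<open>Bessel's bound on the sum of squares can be used only with a nonnegative factor,
    hence the positive part of \<open>\<gamma>\<close>.\<close>
  also have "\<gamma> * (\<Sum>f\<in>F. (f \<bullet> x)\<^sup>2) \<le> max \<gamma> 0 * (\<Sum>f\<in>F. (f \<bullet> x)\<^sup>2)"
    by (rule mult_right_mono) (simp_all add: sum_nonneg)
  also have "\<dots> \<le> max \<gamma> 0 * (x \<bullet> x)"
    by (rule mult_left_mono[OF sum_inner_orthonormal_squares_le[OF F(1,2)]]) (use F(3) in simp_all)
  finally show ?thesis by (simp add: dot_square_norm mult.commute mult.left_commute)
qed

text \<open>The frame is adapted to the sign of \<open>\<gamma>\<close>: if positive, it contains
  the unit vector \<open>e\<close> along \<open>x\<close>; otherwise it is orthogonal to
  \<open>e\<close>, and \<open>k < CARD('n)\<close> leaves room for \<open>k\<close> such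
  vectors.\<close>

lemma P_plus_ge_radial:
  fixes A :: "real^'n^'n"
  assumes sym: "transpose A = A" and k: "1 \<le> k" "k < CARD('n)"
    and ge: "\<And>v. v \<bullet> (A *v v) \<ge> 2 * \<beta> * (v \<bullet> v) + 8 * \<gamma> * (x \<bullet> v)\<^sup>2"
  shows "P_plus k A \<ge> 2 * \<beta> * real k + 8 * (norm x)\<^sup>2 * max \<gamma> 0"
proof -
  obtain e :: "real^'n" where e: "norm e = 1" "x = norm x *\<^sub>R e"
  proof (cases "x = 0")
    case True
    then show ?thesis using that[of "axis undefined 1"] by (simp add: norm_axis_1)
  next
    case False
    then show ?thesis using that[of "x /\<^sub>R norm x"] by simp
  qed
  obtain S where S: "e \<in> S" "pairwise orthogonal S" "\<And>x. x \<in> S \<Longrightarrow> norm x = 1"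
    "independent S" "card S = DIM(real^'n)"
    using vector_in_orthonormal_basis[OF e(1)] by metis
  have fin: "finite S" using S(4) by (rule independent_imp_finite)
  have cardS: "card (S - {e}) = CARD('n) - 1"
    using S(1,5) fin by simp
  have orth: "e \<bullet> f = 0" if "f \<in> S - {e}" for f
    using S(1,2) that by (auto simp: pairwise_def orthogonal_def)
  have xf: "x \<bullet> f = norm x * (e \<bullet> f)" for f
    by (metis e(2) inner_scaleR_left)
  obtain F where F: "F \<subseteq> S" "card F = k" "(\<Sum>f\<in>F. \<gamma> * (x \<bullet> f)\<^sup>2) = (norm x)\<^sup>2 * max \<gamma> 0"
  proof (cases "\<gamma> > 0")
    case True
    obtain G where G: "G \<subseteq> S - {e}" "card G = k - 1" "finite G"
      using obtain_subset_with_card_n[of "k - 1" "S - {e}"] cardS k by (metis diff_le_mono less_imp_le)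
    have eG: "e \<notin> G" using G by auto
    have "(\<Sum>f\<in>insert e G. \<gamma> * (x \<bullet> f)\<^sup>2) = \<gamma> * (norm x)\<^sup>2 * (e \<bullet> e)\<^sup>2 + (\<Sum>f\<in>G. \<gamma> * (x \<bullet> f)\<^sup>2)"
      using G eG by (simp add: xf power_mult_distrib)
    also have "(\<Sum>f\<in>G. \<gamma> * (x \<bullet> f)\<^sup>2) = 0"
      using G(1) orth by (intro sum.neutral ballI) (simp add: xf subset_iff)
    finally show ?thesis
      using that[of "insert e G"] G eG S(1) k True e(1) by (auto simp: norm_eq_1 mult.commute)
  next
    case False
    obtain G where G: "G \<subseteq> S - {e}" "card G = k" "finite G"
      using obtain_subset_with_card_n[of k "S - {e}"] cardS k by (metis less_imp_le_nat Suc_pred' add_diff_cancel_left' le_add1 less_Suc_eq_le plus_1_eq_Suc zero_less_card_finite)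
    have "(\<Sum>f\<in>G. \<gamma> * (x \<bullet> f)\<^sup>2) = 0"
      using G(1) orth by (intro sum.neutral ballI) (simp add: xf subset_iff)
    then show ?thesis using that[of G] G False by auto
  qed
  have fF: "finite F" using F(1) fin finite_subset by blast
  have nF: "norm f = 1" if "f \<in> F" for f using that F(1) S(3) by blast
  have "2 * \<beta> * real k + 8 * (norm x)\<^sup>2 * max \<gamma> 0 = 2 * \<beta> * real k + 8 * (\<Sum>f\<in>F. \<gamma> * (x \<bullet> f)\<^sup>2)"
    using F(3) by simp
  also have "\<dots> = (\<Sum>f\<in>F. 2 * \<beta> * (f \<bullet> f) + 8 * \<gamma> * (x \<bullet> f)\<^sup>2)"
    using nF F(2) by (simp add: sum.distrib norm_eq_1 sum_distrib_left mult.assoc)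
  also have "\<dots> \<le> (\<Sum>f\<in>F. f \<bullet> (A *v f))" by (rule sum_mono) (rule ge)
  also have "\<dots> \<le> P_plus (card F) A"
    by (rule sum_frame_le_P_plus[OF sym fF])
      (use F(1,2) S(2) nF k in \<open>auto intro: pairwise_subset\<close>)
  finally show ?thesis using F(2) by simp
qed

subsection \<open>Second-order conditions at touching points\<close>

text \<open>If \<open>L > 0\<close>, then \<open>D\<close> exceeds \<open>D a = 0\<close> just to
  the right of \<open>a\<close>, and the mean value theorem makes \<open>f\<close> exceed
  \<open>f a\<close> there.\<close>

lemma local_max_second_derivative:
  fixes f D :: "real \<Rightarrow> real"
  assumes f: "\<forall>\<^sub>F t in nhds a. (f has_real_derivative D t) (at t)"
    and D: "(D has_real_derivative L) (at a)"
    and max: "\<forall>\<^sub>F t in nhds a. f t \<le> f a"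
  shows "D a = 0" "L \<le> 0"
proof -
  obtain d where d: "d > 0" "\<And>t. dist t a < d \<Longrightarrow> (f has_real_derivative D t) (at t) \<and> f t \<le> f a"
    using eventually_conj[OF f max] unfolding eventually_nhds_metric by blast
  show D0: "D a = 0"
    by (rule DERIV_local_max[of f _ a d]) (use d in \<open>auto simp: dist_real_def abs_minus_commute\<close>)
  show "L \<le> 0"
  proof (rule ccontr)
    assume "\<not> L \<le> 0"
    then obtain e where e: "e > 0" "\<And>h. 0 < h \<Longrightarrow> h < e \<Longrightarrow> D a < D (a + h)"
      using DERIV_pos_inc_right[OF D] by auto
    define h where "h = min d e / 2"
    have h: "h > 0" "h < d" "h < e" unfolding h_def using d(1) e(1) by auto
    have "\<exists>z. a < z \<and> z < a + h \<and> f (a + h) - f a = (a + h - a) * D z"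
      by (rule MVT2) (use h d(2) in \<open>auto simp: dist_real_def\<close>)
    then obtain z where z: "a < z" "z < a + h" "f (a + h) - f a = h * D z" by auto
    have "D z > 0" using e(2)[of "z - a"] z h D0 by simp
    then have "f (a + h) > f a" using z h by (metis diff_gt_0_iff_gt mult_pos_pos)
    moreover have "f (a + h) \<le> f a" using d(2)[of "a + h"] h by (simp add: dist_real_def)
    ultimately show False by simp
  qed
qed

section \<open>Gradients, Hessians and the symmetry of second derivatives\<close>

lemma gradient_eqI:
  assumes "(\<phi> has_derivative (\<lambda>h. g \<bullet> h)) (at x)"
  shows "gradient \<phi> x = g"
proof -
  have "frechet_derivative \<phi> (at x) = (\<lambda>h. g \<bullet> h)"
    using frechet_derivative_at[OF assms] by simp
  then show ?thesis unfolding gradient_def by (simp add: vec_eq_iff inner_axis)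
qed

lemma hessian_eqI:
  assumes "(gradient \<phi> has_derivative (\<lambda>h. A *v h)) (at x)"
  shows "hessian \<phi> x = A"
proof -
  have "frechet_derivative (gradient \<phi>) (at x) = (\<lambda>h. A *v h)"
    using frechet_derivative_at[OF assms] by simp
  then show ?thesis unfolding hessian_def jacobian_def by simp
qed

lemma has_derivative_gradient:
  fixes \<phi> :: "real^'n \<Rightarrow> real"
  assumes "\<phi> differentiable (at x)"
  shows "(\<phi> has_derivative (\<lambda>h. gradient \<phi> x \<bullet> h)) (at x)"
proof -
  let ?D = "frechet_derivative \<phi> (at x)"
  have D: "(\<phi> has_derivative ?D) (at x)"
    using assms frechet_derivative_works by blast
  then have lin: "linear ?D" by (rule has_derivative_linear)
  have "?D h = gradient \<phi> x \<bullet> h" for h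
  proof -
    have "h = (\<Sum>i\<in>UNIV. h $ i *\<^sub>R axis i 1)"
      using basis_expansion[of h] by (simp add: scalar_mult_eq_scaleR)
    then have "?D h = ?D (\<Sum>i\<in>UNIV. h $ i *\<^sub>R axis i 1)" by simp
    also have "\<dots> = (\<Sum>i\<in>UNIV. h $ i * ?D (axis i 1))"
      by (simp add: linear_sum[OF lin] linear_cmul[OF lin])
    also have "\<dots> = gradient \<phi> x \<bullet> h"
      by (simp add: gradient_def inner_vec_def mult.commute)
    finally show ?thesis .
  qed
  then show ?thesis using D by (metis (no_types, lifting) ext)
qed

lemma C2_nearE:
  fixes \<phi> :: "real^'n \<Rightarrow> real"
  assumes "C2_near \<phi> x0"
  obtains d where "d > 0"
    "\<And>x. dist x x0 < d \<Longrightarrow> (\<phi> has_derivative (\<lambda>h. gradient \<phi> x \<bullet> h)) (at x)"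
    "\<And>x. dist x x0 < d \<Longrightarrow> (gradient \<phi> has_derivative (\<lambda>h. hessian \<phi> x *v h)) (at x)"
proof -
  obtain U where U: "open U" "x0 \<in> U" "\<phi> differentiable_on U" "gradient \<phi> differentiable_on U"
    using assms unfolding C2_near_def by blast
  obtain d where d: "d > 0" "\<And>x. dist x x0 < d \<Longrightarrow> x \<in> U"
    using U(1,2) unfolding open_dist by blast
  show ?thesis
  proof (rule that[OF d(1)])
    fix x assume "dist x x0 < d"
    then have x: "x \<in> U" by (rule d(2))
    show "(\<phi> has_derivative (\<lambda>h. gradient \<phi> x \<bullet> h)) (at x)"
      using U(1,3) x by (intro has_derivative_gradient) (simp add: differentiable_on_eq_differentiable_at)
    show "(gradient \<phi> has_derivative (\<lambda>h. hessian \<phi> x *v h)) (at x)"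
      using U(1,4) x jacobian_works unfolding hessian_def
      by (auto simp: differentiable_on_eq_differentiable_at)
  qed
qed

text \<open>The mixed difference is an increment of \<open>f s\<close>, the difference of
  \<open>\<phi>\<close> in direction \<open>v\<close>. The mean value theorem turns it into a
  difference of two values of \<open>G\<close>, both expanded by the differentiability of
  \<open>G\<close> at the single point \<open>x\<close>.\<close>

lemma second_difference_estimate:
  fixes \<phi> :: "real^'n \<Rightarrow> real"
  assumes d: "d > 0" "\<And>y. dist y x < d \<Longrightarrow> (\<phi> has_derivative (\<lambda>h. G y \<bullet> h)) (at y)"
    and H: "(G has_derivative (\<lambda>h. H *v h)) (at x)" and e: "e > 0"
  shows "\<forall>\<^sub>F t in at_right (0::real).
    \<bar>\<phi> (x + t *\<^sub>R u + t *\<^sub>R v) - \<phi> (x + t *\<^sub>R u) - \<phi> (x + t *\<^sub>R v) + \<phi> x - t\<^sup>2 * (u \<bullet> (H *v v))\<bar> \<le> e * t\<^sup>2"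
proof -
  define K where "K = norm u + norm v + 1"
  have K: "K > 0" "norm u \<le> K" "norm v \<le> K" "norm u + norm v < K"
    unfolding K_def by (auto simp: add_nonneg_pos)
  \<comment> \<open>Two gradient errors of size \<open>e' * t * K\<close>, paired with
    \<open>u\<close> and multiplied by \<open>t\<close>, add up to at most
    \<open>2 * e' * K\<^sup>2 * t\<^sup>2\<close>, which is \<open>e * t\<^sup>2\<close>.\<close>
  define e' where "e' = e / (2 * K\<^sup>2)"
  have e': "e' > 0" unfolding e'_def using e K by simp
  obtain c where c: "c > 0" "\<And>y. norm (y - x) < c \<Longrightarrow> norm (G y - G x - H *v (y - x)) \<le> e' * norm (y - x)"
    using H e' unfolding has_derivative_at_alt by blast
  define t0 where "t0 = min c d / K"
  have t0: "t0 > 0" unfolding t0_def using c d K by simp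
  have "\<bar>\<phi> (x + t *\<^sub>R u + t *\<^sub>R v) - \<phi> (x + t *\<^sub>R u) - \<phi> (x + t *\<^sub>R v) + \<phi> x - t\<^sup>2 * (u \<bullet> (H *v v))\<bar> \<le> e * t\<^sup>2"
    if t: "0 < t" "t < t0" for t
  proof -
    have tK: "t * K < c" "t * K < d"
      using t(2) K(1) unfolding t0_def by (auto simp: field_simps)
    have small: "norm (s *\<^sub>R u + r *\<^sub>R v) \<le> t * K" if "0 \<le> s" "s \<le> t" "0 \<le> r" "r \<le> t" for s r
    proof -
      have "norm (s *\<^sub>R u + r *\<^sub>R v) \<le> s * norm u + r * norm v"
        using norm_triangle_ineq[of "s *\<^sub>R u" "r *\<^sub>R v"] that by simp
      also have "\<dots> \<le> t * norm u + t * norm v"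
        using that by (intro add_mono mult_right_mono) auto
      also have "\<dots> \<le> t * K" using K t by (simp add: distrib_left[symmetric])
      finally show ?thesis .
    qed
    define f where "f s = \<phi> (x + s *\<^sub>R u + t *\<^sub>R v) - \<phi> (x + s *\<^sub>R u)" for s
    have df: "(f has_real_derivative (G (x + s *\<^sub>R u + t *\<^sub>R v) - G (x + s *\<^sub>R u)) \<bullet> u) (at s)"
      if s: "0 \<le> s" "s \<le> t" for s
    proof -
      have a: "dist (x + s *\<^sub>R u + t *\<^sub>R v) x < d" "dist (x + s *\<^sub>R u) x < d"
        using small[of s t] small[of s 0] s t tK by (auto simp: dist_norm add.assoc)
      have "((\<lambda>s. \<phi> (x + s *\<^sub>R u + t *\<^sub>R v)) has_derivative (\<lambda>h. G (x + s *\<^sub>R u + t *\<^sub>R v) \<bullet> (h *\<^sub>R u))) (at s)"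
        by (rule has_derivative_compose[where g = \<phi> and f = "\<lambda>s. x + s *\<^sub>R u + t *\<^sub>R v", OF _ d(2)[OF a(1)]]) (auto intro!: derivative_eq_intros)
      moreover have "((\<lambda>s. \<phi> (x + s *\<^sub>R u)) has_derivative (\<lambda>h. G (x + s *\<^sub>R u) \<bullet> (h *\<^sub>R u))) (at s)"
        by (rule has_derivative_compose[where g = \<phi> and f = "\<lambda>s. x + s *\<^sub>R u", OF _ d(2)[OF a(2)]]) (auto intro!: derivative_eq_intros)
      ultimately have "(f has_derivative (\<lambda>h. G (x + s *\<^sub>R u + t *\<^sub>R v) \<bullet> (h *\<^sub>R u) - G (x + s *\<^sub>R u) \<bullet> (h *\<^sub>R u))) (at s)"
        unfolding f_def by (rule has_derivative_diff)
      then show ?thesis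
        unfolding has_field_derivative_def
        by (rule has_derivative_eq_rhs) (auto simp: inner_diff_left algebra_simps fun_eq_iff)
    qed
    obtain s where s: "0 < s" "s < t"
      "f t - f 0 = (t - 0) * ((G (x + s *\<^sub>R u + t *\<^sub>R v) - G (x + s *\<^sub>R u)) \<bullet> u)"
      using MVT2[of 0 t f "\<lambda>s. (G (x + s *\<^sub>R u + t *\<^sub>R v) - G (x + s *\<^sub>R u)) \<bullet> u"] df t by auto
    define E1 where "E1 = G (x + s *\<^sub>R u + t *\<^sub>R v) - G x - H *v (s *\<^sub>R u + t *\<^sub>R v)"
    define E2 where "E2 = G (x + s *\<^sub>R u) - G x - H *v (s *\<^sub>R u)"
    have est: "e' * norm (s *\<^sub>R u + r *\<^sub>R v) \<le> e' * (t * K)" if "0 \<le> r" "r \<le> t" for r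
      by (intro mult_left_mono small) (use s e' that in auto)
    have E1: "norm E1 \<le> e' * (t * K)"
      using c(2)[of "x + s *\<^sub>R u + t *\<^sub>R v"] small[of s t] est[of t] s t tK
      unfolding E1_def by (simp add: add.assoc)
    have E2: "norm E2 \<le> e' * (t * K)"
      using c(2)[of "x + s *\<^sub>R u"] small[of s 0] est[of 0] s t tK
      unfolding E2_def by simp
    have diff: "G (x + s *\<^sub>R u + t *\<^sub>R v) - G (x + s *\<^sub>R u) = t *\<^sub>R (H *v v) + (E1 - E2)"
      unfolding E1_def E2_def by (simp add: matrix_vector_right_distrib matrix_vector_mult_scaleR)
    have "f t - f 0 - t\<^sup>2 * (u \<bullet> (H *v v)) = t * ((E1 - E2) \<bullet> u)"
      unfolding s(3) diff by (simp add: inner_add_left inner_add_right power2_eq_square inner_commute distrib_left)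
    also have "\<bar>\<dots>\<bar> \<le> t * ((e' * (t * K) + e' * (t * K)) * K)"
    proof -
      have "\<bar>(E1 - E2) \<bullet> u\<bar> \<le> norm (E1 - E2) * norm u" by (rule Cauchy_Schwarz_ineq2)
      also have "\<dots> \<le> (e' * (t * K) + e' * (t * K)) * K"
        by (intro mult_mono order.trans[OF norm_triangle_ineq4] add_mono E1 E2)
          (use K e' t in auto)
      finally show ?thesis using t by (simp add: abs_mult)
    qed
    also have "\<dots> = e * t\<^sup>2"
      unfolding e'_def using K(1) by (simp add: power2_eq_square field_simps)
    finally show ?thesis unfolding f_def by (simp add: algebra_simps)
  qed
  then show ?thesis
    unfolding eventually_at_right_field using t0 by (intro exI[of _ t0]) auto
qed

text \<open>The second difference does not change when \<open>u\<close> and \<open>v\<close> are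
  exchanged, so its leading term \<open>u \<bullet> (?H *v v)\<close> does not either. The spectral
  results apply to Hessians only through this symmetry.\<close>

lemma transpose_hessian:
  fixes \<phi> :: "real^'n \<Rightarrow> real"
  assumes "C2_near \<phi> x"
  shows "transpose (hessian \<phi> x) = hessian \<phi> x"
proof -
  let ?H = "hessian \<phi> x"
  obtain d where d: "d > 0"
    "\<And>y. dist y x < d \<Longrightarrow> (\<phi> has_derivative (\<lambda>h. gradient \<phi> y \<bullet> h)) (at y)"
    "\<And>y. dist y x < d \<Longrightarrow> (gradient \<phi> has_derivative (\<lambda>h. hessian \<phi> y *v h)) (at y)"
    using C2_nearE[OF assms] by blast
  have H: "(gradient \<phi> has_derivative (\<lambda>h. ?H *v h)) (at x)" using d by simp
  have le: "\<bar>u \<bullet> (?H *v v) - v \<bullet> (?H *v u)\<bar> \<le> 0 + e" if "e > 0" for u v e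
  proof -
    let ?S = "\<lambda>t u v. \<phi> (x + t *\<^sub>R u + t *\<^sub>R v) - \<phi> (x + t *\<^sub>R u) - \<phi> (x + t *\<^sub>R v) + \<phi> x"
    have "e / 2 > 0" using that by simp
    note est = second_difference_estimate[OF d(1,2) H this]
    have "\<forall>\<^sub>F t in at_right (0::real). t > 0 \<and> \<bar>?S t u v - t\<^sup>2 * (u \<bullet> (?H *v v))\<bar> \<le> e/2 * t\<^sup>2
        \<and> \<bar>?S t v u - t\<^sup>2 * (v \<bullet> (?H *v u))\<bar> \<le> e/2 * t\<^sup>2"
      by (intro eventually_conj est eventually_at_right_less)
    then obtain t where t: "t > 0" "\<bar>?S t u v - t\<^sup>2 * (u \<bullet> (?H *v v))\<bar> \<le> e/2 * t\<^sup>2"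
        "\<bar>?S t v u - t\<^sup>2 * (v \<bullet> (?H *v u))\<bar> \<le> e/2 * t\<^sup>2"
      using eventually_happens'[OF trivial_limit_at_right_real] by blast
    have "?S t u v = ?S t v u" by (simp add: add.commute add.left_commute)
    then have "\<bar>t\<^sup>2 * (u \<bullet> (?H *v v)) - t\<^sup>2 * (v \<bullet> (?H *v u))\<bar> \<le> e * t\<^sup>2"
      using t(2,3) by linarith
    then have "t\<^sup>2 * \<bar>u \<bullet> (?H *v v) - v \<bullet> (?H *v u)\<bar> \<le> t\<^sup>2 * e"
      by (simp add: right_diff_distrib[symmetric] abs_mult mult.commute)
    then show ?thesis using t(1) by simp
  qed
  have eq: "u \<bullet> (?H *v v) = v \<bullet> (?H *v u)" for u v
    using field_le_epsilon[OF le[of _ u v]] by simp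
  have "?H $ i $ j = ?H $ j $ i" for i j
    using eq[of "axis i 1" "axis j 1"]
    by (simp add: inner_axis' matrix_vector_mult_basis column_def)
  then show ?thesis by (simp add: vec_eq_iff transpose_def)
qed

text \<open>Restriction to the lines \<open>x + t *\<^sub>R v\<close> reduces the claim to the
  one-variable conditions at a maximum.\<close>

lemma touching_second_order:
  fixes \<phi> \<psi> :: "real^'n \<Rightarrow> real"
  assumes \<phi>: "C2_near \<phi> x" and \<psi>: "C2_near \<psi> x"
    and max: "\<forall>\<^sub>F y in nhds x. \<phi> y - \<psi> y \<le> \<phi> x - \<psi> x"
  shows "gradient \<phi> x = gradient \<psi> x" "v \<bullet> (hessian \<phi> x *v v) \<le> v \<bullet> (hessian \<psi> x *v v)"
proof -
  obtain d1 where d1: "d1 > 0"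
    "\<And>y. dist y x < d1 \<Longrightarrow> (\<phi> has_derivative (\<lambda>h. gradient \<phi> y \<bullet> h)) (at y)"
    "\<And>y. dist y x < d1 \<Longrightarrow> (gradient \<phi> has_derivative (\<lambda>h. hessian \<phi> y *v h)) (at y)"
    using C2_nearE[OF \<phi>] by blast
  obtain d2 where d2: "d2 > 0"
    "\<And>y. dist y x < d2 \<Longrightarrow> (\<psi> has_derivative (\<lambda>h. gradient \<psi> y \<bullet> h)) (at y)"
    "\<And>y. dist y x < d2 \<Longrightarrow> (gradient \<psi> has_derivative (\<lambda>h. hessian \<psi> y *v h)) (at y)"
    using C2_nearE[OF \<psi>] by blast
  have key: "(gradient \<phi> x - gradient \<psi> x) \<bullet> v = 0 \<and>
    v \<bullet> (hessian \<phi> x *v v) - v \<bullet> (hessian \<psi> x *v v) \<le> 0" for v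
  proof -
    define f where "f t = \<phi> (x + t *\<^sub>R v) - \<psi> (x + t *\<^sub>R v)" for t
    define D where "D t = gradient \<phi> (x + t *\<^sub>R v) \<bullet> v - gradient \<psi> (x + t *\<^sub>R v) \<bullet> v" for t
    have lim: "((\<lambda>t. x + t *\<^sub>R v) \<longlongrightarrow> x) (nhds 0)"
      by (rule tendsto_eq_rhs[OF tendsto_add[OF tendsto_const tendsto_scaleR[OF filterlim_ident tendsto_const]]]) simp
    have near: "\<forall>\<^sub>F t in nhds 0. dist (x + t *\<^sub>R v) x < min d1 d2"
      using lim d1(1) d2(1) by (intro tendstoD) auto
    have 1: "\<forall>\<^sub>F t in nhds 0. (f has_real_derivative D t) (at t)"
      using near
    proof eventually_elim
      case (elim t)
      have "((\<lambda>t. \<phi> (x + t *\<^sub>R v)) has_derivative (\<lambda>h. gradient \<phi> (x + t *\<^sub>R v) \<bullet> (h *\<^sub>R v))) (at t)"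
        by (rule has_derivative_compose[OF _ d1(2)]) (use elim in \<open>auto intro!: derivative_eq_intros\<close>)
      moreover have "((\<lambda>t. \<psi> (x + t *\<^sub>R v)) has_derivative (\<lambda>h. gradient \<psi> (x + t *\<^sub>R v) \<bullet> (h *\<^sub>R v))) (at t)"
        by (rule has_derivative_compose[OF _ d2(2)]) (use elim in \<open>auto intro!: derivative_eq_intros\<close>)
      ultimately show ?case
        unfolding f_def D_def has_field_derivative_def
        by (rule has_derivative_eq_rhs[OF has_derivative_diff]) (auto simp: fun_eq_iff algebra_simps)
    qed
    have 2: "(D has_real_derivative v \<bullet> (hessian \<phi> x *v v) - v \<bullet> (hessian \<psi> x *v v)) (at 0)"
    proof -
      have "((\<lambda>t. gradient \<phi> (x + t *\<^sub>R v)) has_derivative (\<lambda>h. hessian \<phi> (x + 0 *\<^sub>R v) *v (h *\<^sub>R v))) (at 0)"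
        by (rule has_derivative_compose[OF _ d1(3)]) (use d1 in \<open>auto intro!: derivative_eq_intros\<close>)
      moreover have "((\<lambda>t. gradient \<psi> (x + t *\<^sub>R v)) has_derivative (\<lambda>h. hessian \<psi> (x + 0 *\<^sub>R v) *v (h *\<^sub>R v))) (at 0)"
        by (rule has_derivative_compose[OF _ d2(3)]) (use d2 in \<open>auto intro!: derivative_eq_intros\<close>)
      ultimately show ?thesis
        unfolding D_def has_field_derivative_def
        by (rule has_derivative_eq_rhs[OF has_derivative_diff[OF has_derivative_inner_left has_derivative_inner_left]])
          (auto simp: fun_eq_iff algebra_simps matrix_vector_mult_scaleR inner_commute)
    qed
    have 3: "\<forall>\<^sub>F t in nhds 0. f t \<le> f 0"
      using eventually_compose_filterlim[OF max lim] unfolding f_def by simp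
    show ?thesis
      using local_max_second_derivative[OF 1 2 3] unfolding D_def by (simp add: inner_diff_left)
  qed
  show "gradient \<phi> x = gradient \<psi> x"
    using key[of "gradient \<phi> x - gradient \<psi> x"] by simp
  show "v \<bullet> (hessian \<phi> x *v v) \<le> v \<bullet> (hessian \<psi> x *v v)"
    using key[of v] by simp
qed

text \<open>With \<open>q\<close> the squared norm of the touching point, \<open>a\<close> is the
  value there, the gradient there is \<open>2 * \<beta>\<close> times the position vector, and
  \<open>\<gamma>\<close> enters only from the Hessian on.\<close>

definition radial_quartic :: "real \<Rightarrow> real \<Rightarrow> real \<Rightarrow> real \<Rightarrow> real^'n \<Rightarrow> real" where
  "radial_quartic a \<beta> \<gamma> q x = a + \<beta> * (x \<bullet> x - q) + \<gamma> * (x \<bullet> x - q)\<^sup>2"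

lemma has_derivative_radial_quartic:
  "(radial_quartic a \<beta> \<gamma> q has_derivative (\<lambda>h. ((2 * \<beta> + 4 * \<gamma> * (x \<bullet> x - q)) *\<^sub>R x) \<bullet> h)) (at x)"
  unfolding radial_quartic_def
  by (auto intro!: derivative_eq_intros simp: fun_eq_iff algebra_simps inner_commute)

lemma gradient_radial_quartic:
  "gradient (radial_quartic a \<beta> \<gamma> q) = (\<lambda>x. (2 * \<beta> + 4 * \<gamma> * (x \<bullet> x - q)) *\<^sub>R x)"
  using gradient_eqI[OF has_derivative_radial_quartic] by blast

lemma matrix_vector_mult_scalar_plus_rank_one:
  fixes x h :: "real^'n"
  shows "(\<chi> i j. (if i = j then c else 0) + d * (x $ i * x $ j)) *v h = c *\<^sub>R h + (d * (x \<bullet> h)) *\<^sub>R x"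
proof -
  have "(\<Sum>j\<in>UNIV. ((if i = j then c else 0) + d * (x $ i * x $ j)) * h $ j)
      = c * h $ i + d * (x \<bullet> h) * x $ i" for i
  proof -
    have "(\<Sum>j\<in>UNIV. ((if i = j then c else 0) + d * (x $ i * x $ j)) * h $ j)
        = (\<Sum>j\<in>UNIV. (if i = j then c * h $ j else 0)) + (\<Sum>j\<in>UNIV. d * x $ i * (x $ j * h $ j))"
      unfolding sum.distrib[symmetric] by (rule sum.cong) (auto simp: algebra_simps)
    also have "(\<Sum>j\<in>UNIV. d * x $ i * (x $ j * h $ j)) = d * x $ i * (x \<bullet> h)"
      by (simp add: sum_distrib_left inner_vec_def)
    finally show ?thesis by simp
  qed
  then show ?thesis by (simp add: vec_eq_iff matrix_vector_mult_def)
qed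

lemma has_derivative_gradient_radial_quartic:
  fixes x :: "real^'n"
  shows "(gradient (radial_quartic a \<beta> \<gamma> q) has_derivative
    (\<lambda>h. (\<chi> i j. (if i = j then 2 * \<beta> + 4 * \<gamma> * (x \<bullet> x - q) else 0) + 8 * \<gamma> * (x $ i * x $ j)) *v h)) (at x)"
  unfolding gradient_radial_quartic matrix_vector_mult_scalar_plus_rank_one
  by (auto intro!: derivative_eq_intros simp: fun_eq_iff algebra_simps inner_commute)

lemma hessian_radial_quartic:
  "hessian (radial_quartic a \<beta> \<gamma> q) = (\<lambda>x. \<chi> i j. (if i = j then 2 * \<beta> + 4 * \<gamma> * (x \<bullet> x - q) else 0)
     + 8 * \<gamma> * (x $ i * x $ j))"
  using hessian_eqI[OF has_derivative_gradient_radial_quartic] by blast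

lemma hessian_radial_quartic_form:
  "v \<bullet> (hessian (radial_quartic a \<beta> \<gamma> (x \<bullet> x)) x *v v) = 2 * \<beta> * (v \<bullet> v) + 8 * \<gamma> * (x \<bullet> v)\<^sup>2"
proof -
  have "hessian (radial_quartic a \<beta> \<gamma> (x \<bullet> x)) x *v v = (2 * \<beta>) *\<^sub>R v + (8 * \<gamma> * (x \<bullet> v)) *\<^sub>R x"
    unfolding hessian_radial_quartic matrix_vector_mult_scalar_plus_rank_one by simp
  then show ?thesis by (simp add: inner_add_right power2_eq_square inner_commute)
qed

lemma C2_near_radial_quartic:
  fixes x :: "real^'n"
  shows "C2_near (radial_quartic a \<beta> \<gamma> q) x"
  unfolding C2_near_def
proof (intro exI[of _ UNIV] conjI)
  let ?\<psi> = "radial_quartic a \<beta> \<gamma> q :: real^'n \<Rightarrow> real"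
  show "?\<psi> differentiable_on UNIV"
    by (simp add: differentiable_on_eq_differentiable_at differentiableI[OF has_derivative_radial_quartic])
  show "gradient ?\<psi> differentiable_on UNIV"
    by (simp add: differentiable_on_eq_differentiable_at differentiableI[OF has_derivative_gradient_radial_quartic])
  show "continuous_on UNIV (hessian ?\<psi>)"
    unfolding hessian_radial_quartic
  proof (rule continuous_on_vec_lambda, rule continuous_on_vec_lambda)
    fix i j :: 'n
    have "continuous_on UNIV (\<lambda>x::real^'n. if i = j then 2 * \<beta> + 4 * \<gamma> * (x \<bullet> x - q) else 0)"
    proof (cases "i = j")
      case True
      show ?thesis unfolding if_P[OF True] by (intro continuous_intros)
    qed simp
    moreover have "continuous_on UNIV (\<lambda>x::real^'n. 8 * \<gamma> * (x $ i * x $ j))"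
      by (intro continuous_intros)
    ultimately show "continuous_on UNIV (\<lambda>x::real^'n. (if i = j then 2 * \<beta> + 4 * \<gamma> * (x \<bullet> x - q) else 0) + 8 * \<gamma> * (x $ i * x $ j))"
      by (rule continuous_on_add)
  qed
qed auto

subsection \<open>Viscosity solutions and radial test functions\<close>

text \<open>The value of the differential operator at \<open>x\<close>, \<open>|x| = r\<close>, on a radial quartic with
  \<open>q = x \<bullet> x\<close>.\<close>

definition jet_operator :: "nat \<Rightarrow> (real \<Rightarrow> real) \<Rightarrow> real \<Rightarrow> real \<Rightarrow> real \<Rightarrow> real" where
  "jet_operator k b r \<beta> \<gamma> = 2 * \<beta> * real k + 8 * r\<^sup>2 * max \<gamma> 0 + b r * (2 * \<bar>\<beta>\<bar> * r)"

lemma jet_operator_scale: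
  "0 \<le> c \<Longrightarrow> jet_operator k b r (c * \<beta>) (c * \<gamma>) = c * jet_operator k b r \<beta> \<gamma>"
proof -
  assume c: "0 \<le> c"
  then have "max (c * \<gamma>) 0 = c * max \<gamma> 0"
    by (auto simp: max_def mult_le_0_iff zero_le_mult_iff)
  then show ?thesis
    using c by (simp add: jet_operator_def abs_mult algebra_simps)
qed

lemma norm_gradient_radial_quartic:
  "norm (gradient (radial_quartic a \<beta> \<gamma> (x \<bullet> x)) x) = 2 * \<bar>\<beta>\<bar> * norm x"
  by (simp add: gradient_radial_quartic abs_mult)

text \<open>At the touching point the gradients agree and the Hessians are ordered as quadratic
  forms, so the eigenvalue bound for radial forms applies although \<open>\<phi>\<close> need not be
  radial.\<close>

lemma operator_le_jet_operator:
  fixes \<phi> :: "real^'n \<Rightarrow> real"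
  assumes k: "k \<le> CARD('n)" and \<phi>: "C2_near \<phi> x"
    and max: "\<forall>\<^sub>F y in nhds x. \<phi> y - radial_quartic a \<beta> \<gamma> (x \<bullet> x) y \<le> \<phi> x - radial_quartic a \<beta> \<gamma> (x \<bullet> x) x"
  shows "P_plus k (hessian \<phi> x) + b (norm x) * norm (gradient \<phi> x) \<le> jet_operator k b (norm x) \<beta> \<gamma>"
proof -
  note t = touching_second_order[OF \<phi> C2_near_radial_quartic max]
  have "P_plus k (hessian \<phi> x) \<le> 2 * \<beta> * real k + 8 * (norm x)\<^sup>2 * max \<gamma> 0"
    using t(2) by (intro P_plus_le_radial[OF transpose_hessian[OF \<phi>] k]) (simp add: hessian_radial_quartic_form)
  then show ?thesis
    unfolding jet_operator_def t(1) norm_gradient_radial_quartic by simp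
qed

lemma operator_ge_jet_operator:
  fixes \<phi> :: "real^'n \<Rightarrow> real"
  assumes k: "1 \<le> k" "k < CARD('n)" and \<phi>: "C2_near \<phi> x"
    and max: "\<forall>\<^sub>F y in nhds x. radial_quartic a \<beta> \<gamma> (x \<bullet> x) y - \<phi> y \<le> radial_quartic a \<beta> \<gamma> (x \<bullet> x) x - \<phi> x"
  shows "P_plus k (hessian \<phi> x) + b (norm x) * norm (gradient \<phi> x) \<ge> jet_operator k b (norm x) \<beta> \<gamma>"
proof -
  note t = touching_second_order[OF C2_near_radial_quartic \<phi> max]
  have "P_plus k (hessian \<phi> x) \<ge> 2 * \<beta> * real k + 8 * (norm x)\<^sup>2 * max \<gamma> 0"
    using t(2) by (intro P_plus_ge_radial[OF transpose_hessian[OF \<phi>] k]) (simp add: hessian_radial_quartic_form)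
  then show ?thesis
    unfolding jet_operator_def t(1)[symmetric] norm_gradient_radial_quartic by simp
qed

text \<open>A test function touching \<open>u\<close> from below also lies below every quartic
  touching \<open>u\<close> from above at the same point. It is therefore controlled by one quartic
  for each \<open>\<delta>\<close>, and \<open>\<delta>\<close> tends to 0 while the test function
  stays fixed.\<close>

lemma visc_supersolution_if_jets:
  fixes u :: "real^'n \<Rightarrow> real"
  assumes k: "k \<le> CARD('n)" and lsc: "lsc_on \<Omega> u"
    and jets: "\<And>x \<delta>. x \<in> \<Omega> \<Longrightarrow> 0 < \<delta> \<Longrightarrow> \<exists>\<beta> \<gamma>. jet_operator k b (norm x) \<beta> \<gamma> \<le> -1 + \<delta> \<and>
      (\<forall>\<^sub>F y in nhds x. u y \<le> radial_quartic (u x) \<beta> \<gamma> (x \<bullet> x) y)"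
  shows "visc_supersolution k b \<Omega> u"
  unfolding visc_supersolution_def
proof (intro conjI lsc ballI allI impI)
  fix x \<phi> assume x: "x \<in> \<Omega>" and \<phi>: "C2_near \<phi> x \<and> local_min_at (\<lambda>y. u y - \<phi> y) x"
  show "P_plus k (hessian \<phi> x) + b (norm x) * norm (gradient \<phi> x) \<le> -1"
  proof (rule field_le_epsilon)
    fix \<delta> :: real assume "0 < \<delta>"
    from jets[OF x this] obtain \<beta> \<gamma> where j: "jet_operator k b (norm x) \<beta> \<gamma> \<le> -1 + \<delta>"
      "\<forall>\<^sub>F y in nhds x. u y \<le> radial_quartic (u x) \<beta> \<gamma> (x \<bullet> x) y" by blast
    have "\<forall>\<^sub>F y in nhds x. \<phi> y - radial_quartic (u x) \<beta> \<gamma> (x \<bullet> x) y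
        \<le> \<phi> x - radial_quartic (u x) \<beta> \<gamma> (x \<bullet> x) x"
      using j(2) \<phi>[THEN conjunct2, unfolded local_min_at_def]
      by eventually_elim (simp add: radial_quartic_def)
    then show "P_plus k (hessian \<phi> x) + b (norm x) * norm (gradient \<phi> x) \<le> -1 + \<delta>"
      using operator_le_jet_operator[OF k \<phi>[THEN conjunct1]] j(1) order_trans by blast
  qed
qed

lemma visc_subsolution_if_jets:
  fixes u :: "real^'n \<Rightarrow> real"
  assumes k: "1 \<le> k" "k < CARD('n)" and usc: "usc_on \<Omega> u"
    and jets: "\<And>x \<delta>. x \<in> \<Omega> \<Longrightarrow> 0 < \<delta> \<Longrightarrow> \<exists>\<beta> \<gamma>. jet_operator k b (norm x) \<beta> \<gamma> \<ge> -1 - \<delta> \<and>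
      (\<forall>\<^sub>F y in nhds x. u y \<ge> radial_quartic (u x) \<beta> \<gamma> (x \<bullet> x) y)"
  shows "visc_subsolution k b \<Omega> u"
  unfolding visc_subsolution_def
proof (intro conjI usc ballI allI impI)
  fix x \<phi> assume x: "x \<in> \<Omega>" and \<phi>: "C2_near \<phi> x \<and> local_max_at (\<lambda>y. u y - \<phi> y) x"
  let ?F = "P_plus k (hessian \<phi> x) + b (norm x) * norm (gradient \<phi> x)"
  have "-1 \<le> ?F"
  proof (rule field_le_epsilon)
    fix \<delta> :: real assume "0 < \<delta>"
    from jets[OF x this] obtain \<beta> \<gamma> where j: "jet_operator k b (norm x) \<beta> \<gamma> \<ge> -1 - \<delta>"
      "\<forall>\<^sub>F y in nhds x. u y \<ge> radial_quartic (u x) \<beta> \<gamma> (x \<bullet> x) y" by blast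
    have "\<forall>\<^sub>F y in nhds x. radial_quartic (u x) \<beta> \<gamma> (x \<bullet> x) y - \<phi> y
        \<le> radial_quartic (u x) \<beta> \<gamma> (x \<bullet> x) x - \<phi> x"
      using j(2) \<phi>[THEN conjunct2, unfolded local_max_at_def]
      by eventually_elim (simp add: radial_quartic_def)
    from operator_ge_jet_operator[OF k \<phi>[THEN conjunct1] this, of b] j(1)
    show "-1 \<le> ?F + \<delta>" by linarith
  qed
  then show "?F \<ge> -1" .
qed

section \<open>Semicontinuous minima and comparison with strict barriers\<close>

lemma lsc_attains_inf:
  fixes f :: "'a::topological_space \<Rightarrow> real"
  assumes S: "compact S" "S \<noteq> {}" and lsc: "lsc_on S f"
  obtains x where "x \<in> S" "\<And>y. y \<in> S \<Longrightarrow> f x \<le> f y"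
proof (rule ccontr)
  assume "\<not> thesis"
  then have neg: "\<forall>x\<in>S. \<exists>y\<in>S. f y < f x" using that by (metis linorder_not_le)
  \<comment> \<open>Without a minimum the sets \<open>{x \<in> S. f y < f x}\<close> cover
    \<open>S\<close>; a finite subfamily misses the index with the smallest value of
    \<open>f\<close>.\<close>
  have "\<exists>U. open U \<and> U \<inter> S = {x \<in> S. f y < f x}" for y
  proof -
    have "\<exists>V. open V \<and> x \<in> V \<and> V \<inter> S \<subseteq> {x \<in> S. f y < f x}" if "x \<in> S" "f y < f x" for x
    proof -
      have "\<forall>\<^sub>F z in at x within S. f y < f z" using lsc that unfolding lsc_on_def by blast
      then obtain V where "open V" "x \<in> V" "\<forall>z\<in>V. z \<noteq> x \<longrightarrow> z \<in> S \<longrightarrow> f y < f z"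
        unfolding eventually_at_topological by blast
      then show ?thesis using that by (intro exI[of _ V]) auto
    qed
    then obtain V where V: "\<And>x. x \<in> S \<Longrightarrow> f y < f x \<Longrightarrow> open (V x) \<and> x \<in> V x \<and> V x \<inter> S \<subseteq> {x \<in> S. f y < f x}"
      by metis
    show ?thesis
    proof (intro exI conjI)
      show "open (\<Union>x\<in>{x \<in> S. f y < f x}. V x)" using V by auto
      show "(\<Union>x\<in>{x \<in> S. f y < f x}. V x) \<inter> S = {x \<in> S. f y < f x}" using V by blast
    qed
  qed
  then obtain U where U: "\<And>y. open (U y)" "\<And>y. U y \<inter> S = {x \<in> S. f y < f x}" by metis
  have "S \<subseteq> (\<Union>y\<in>S. U y)" using neg U(2) by blast
  then obtain C where C: "C \<subseteq> S" "finite C" "S \<subseteq> (\<Union>y\<in>C. U y)"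
    using compactE_image[OF S(1), of S U] U(1) by metis
  have "C \<noteq> {}" using C(3) S(2) by auto
  then have "Min (f ` C) \<in> f ` C" using C(2) by simp
  then obtain y where "y \<in> C" "f y = Min (f ` C)" by auto
  with C(2) have y: "y \<in> C" "\<And>z. z \<in> C \<Longrightarrow> f y \<le> f z" by auto
  then obtain z where "z \<in> C" "y \<in> U z" using C by blast
  then have "f z < f y" using U(2)[of z] y(1) C(1) by blast
  then show False using y(2)[OF \<open>z \<in> C\<close>] by simp
qed

lemma continuous_on_imp_lsc_on: "continuous_on S f \<Longrightarrow> lsc_on S f"
  unfolding lsc_on_def continuous_on_def by (auto intro: order_tendstoD(1))

lemma continuous_on_imp_usc_on: "continuous_on S f \<Longrightarrow> usc_on S f"
  unfolding usc_on_def continuous_on_def by (auto intro: order_tendstoD(2))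

lemma lsc_on_subset: "lsc_on S f \<Longrightarrow> T \<subseteq> S \<Longrightarrow> lsc_on T f"
  unfolding lsc_on_def by (auto intro: filter_leD[OF at_le])

lemma lsc_on_diff_continuous:
  assumes f: "lsc_on S f" and g: "continuous_on S g"
  shows "lsc_on S (\<lambda>x. f x - g x)"
  unfolding lsc_on_def
proof (intro ballI allI impI)
  fix x a assume x: "x \<in> S" "a < f x - g x"
  define e where "e = (f x - g x - a) / 2"
  have e: "e > 0" using x(2) unfolding e_def by simp
  have "\<forall>\<^sub>F y in at x within S. f x - e < f y"
    using f x(1) e unfolding lsc_on_def by simp
  moreover have "\<forall>\<^sub>F y in at x within S. g y < g x + e"
    using g x(1) e unfolding continuous_on_def by (intro order_tendstoD) auto
  ultimately show "\<forall>\<^sub>F y in at x within S. a < f y - g y"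
    by eventually_elim (simp add: e_def field_simps)
qed

text \<open>At an interior maximum of \<open>v - U\<close> the quartic touching \<open>U\<close>
  from above is, up to a constant, also an admissible test function for \<open>v\<close>. The strict
  inequality for its jet contradicts the subsolution property, so the maximum lies on the
  sphere.\<close>

lemma visc_subsolution_le_strict_supersolution:
  fixes v U :: "real^'n \<Rightarrow> real"
  assumes k: "k \<le> CARD('n)" and \<rho>: "0 < \<rho>"
    and v: "visc_subsolution k b (ball 0 \<rho>) v" "continuous_on (cball 0 \<rho>) v"
    and U: "continuous_on (cball 0 \<rho>) U"
    and jets: "\<And>x. x \<in> ball 0 \<rho> \<Longrightarrow> \<exists>\<beta> \<gamma>. jet_operator k b (norm x) \<beta> \<gamma> < -1 \<and>
      (\<forall>\<^sub>F y in nhds x. U y \<le> radial_quartic (U x) \<beta> \<gamma> (x \<bullet> x) y)"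
    and bd: "\<And>x. x \<in> sphere 0 \<rho> \<Longrightarrow> v x \<le> U x" and x: "x \<in> cball 0 \<rho>"
  shows "v x \<le> U x"
proof -
  have "continuous_on (cball 0 \<rho>) (\<lambda>x. v x - U x)" using v(2) U by (intro continuous_intros)
  then obtain z where z: "z \<in> cball 0 \<rho>" "\<And>y. y \<in> cball 0 \<rho> \<Longrightarrow> v y - U y \<le> v z - U z"
    using continuous_attains_sup[of "cball 0 \<rho>" "\<lambda>x. v x - U x"] \<rho> by auto
  have "z \<notin> ball 0 \<rho>"
  proof
    assume zb: "z \<in> ball 0 \<rho>"
    then obtain \<beta> \<gamma> where j: "jet_operator k b (norm z) \<beta> \<gamma> < -1"
      "\<forall>\<^sub>F y in nhds z. U y \<le> radial_quartic (U z) \<beta> \<gamma> (z \<bullet> z) y" using jets by blast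
    let ?\<psi> = "radial_quartic (U z) \<beta> \<gamma> (z \<bullet> z)"
    have zn: "\<forall>\<^sub>F y in nhds z. y \<in> ball 0 \<rho>" using zb by (intro eventually_nhds_in_open) auto
    have "local_max_at (\<lambda>y. v y - ?\<psi> y) z"
      unfolding local_max_at_def using j(2) zn
    proof eventually_elim
      case (elim y)
      then show ?case using z(2)[of y] by (simp add: radial_quartic_def)
    qed
    then have "P_plus k (hessian ?\<psi> z) + b (norm z) * norm (gradient ?\<psi> z) \<ge> -1"
      using v(1) zb C2_near_radial_quartic unfolding visc_subsolution_def by blast
    moreover have "P_plus k (hessian ?\<psi> z) + b (norm z) * norm (gradient ?\<psi> z) \<le> jet_operator k b (norm z) \<beta> \<gamma>"
      by (rule operator_le_jet_operator[where a = "U z", OF k C2_near_radial_quartic]) simp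
    ultimately show False using j(1) by simp
  qed
  then have "v z - U z \<le> 0" using bd[of z] z(1) by simp
  then show ?thesis using z(2)[OF x] by simp
qed

text \<open>Mirror image of the previous comparison, for a \<open>v\<close> that is only lower
  semicontinuous. Two radii occur because a supersolution on \<open>ball 0 \<rho>'\<close> is also
  compared on smaller balls, up to whose sphere the barrier is continuous.\<close>

lemma strict_subsolution_le_visc_supersolution:
  fixes v U :: "real^'n \<Rightarrow> real"
  assumes k: "1 \<le> k" "k < CARD('n)" and \<rho>: "0 < \<rho>" "\<rho> \<le> \<rho>'"
    and v: "visc_supersolution k b (ball 0 \<rho>') v" "lsc_on (cball 0 \<rho>) v"
    and U: "continuous_on (cball 0 \<rho>) U"
    and jets: "\<And>x. x \<in> ball 0 \<rho> \<Longrightarrow> \<exists>\<beta> \<gamma>. jet_operator k b (norm x) \<beta> \<gamma> > -1 \<and>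
      (\<forall>\<^sub>F y in nhds x. U y \<ge> radial_quartic (U x) \<beta> \<gamma> (x \<bullet> x) y)"
    and bd: "\<And>x. x \<in> sphere 0 \<rho> \<Longrightarrow> U x \<le> v x" and x: "x \<in> cball 0 \<rho>"
  shows "U x \<le> v x"
proof -
  obtain z where z: "z \<in> cball 0 \<rho>" "\<And>y. y \<in> cball 0 \<rho> \<Longrightarrow> v z - U z \<le> v y - U y"
    using lsc_attains_inf[OF _ _ lsc_on_diff_continuous[OF v(2) U]] \<rho> by auto
  have "z \<notin> ball 0 \<rho>"
  proof
    assume zb: "z \<in> ball 0 \<rho>"
    then obtain \<beta> \<gamma> where j: "jet_operator k b (norm z) \<beta> \<gamma> > -1"
      "\<forall>\<^sub>F y in nhds z. U y \<ge> radial_quartic (U z) \<beta> \<gamma> (z \<bullet> z) y" using jets by blast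
    let ?\<psi> = "radial_quartic (U z) \<beta> \<gamma> (z \<bullet> z)"
    have zn: "\<forall>\<^sub>F y in nhds z. y \<in> ball 0 \<rho>" using zb by (intro eventually_nhds_in_open) auto
    have "local_min_at (\<lambda>y. v y - ?\<psi> y) z"
      unfolding local_min_at_def using j(2) zn
    proof eventually_elim
      case (elim y)
      then show ?case using z(2)[of y] by (simp add: radial_quartic_def)
    qed
    moreover have "z \<in> ball 0 \<rho>'" using zb \<rho> by simp
    ultimately have "P_plus k (hessian ?\<psi> z) + b (norm z) * norm (gradient ?\<psi> z) \<le> -1"
      using v(1) C2_near_radial_quartic unfolding visc_supersolution_def by blast
    moreover have "P_plus k (hessian ?\<psi> z) + b (norm z) * norm (gradient ?\<psi> z) \<ge> jet_operator k b (norm z) \<beta> \<gamma>"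
      by (rule operator_ge_jet_operator[where a = "U z", OF k C2_near_radial_quartic]) simp
    ultimately show False using j(1) by simp
  qed
  then have "v z - U z \<ge> 0" using bd[of z] z(1) by simp
  then show ?thesis using z(2)[OF x] by simp
qed

subsection \<open>The radial equation\<close>

text \<open>The comparison curve is \<open>\<kappa> * s\<^sup>2\<close>, with slope
  \<open>2 * r * \<kappa>\<close> at \<open>r\<close>, instead of a line because the test functions
  are polynomials in \<open>s\<^sup>2\<close>.\<close>

lemma derivative_above_parabola:
  fixes f :: "real \<Rightarrow> real"
  assumes f: "(f has_real_derivative f') (at r)" and \<kappa>: "2 * r * \<kappa> < f'"
  shows "\<exists>d>0. \<forall>s. \<bar>s - r\<bar> < d \<longrightarrow> (r < s \<longrightarrow> \<kappa> * (s\<^sup>2 - r\<^sup>2) \<le> f s - f r) \<and>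
    (s < r \<longrightarrow> f s - f r \<le> \<kappa> * (s\<^sup>2 - r\<^sup>2))"
proof -
  have h: "((\<lambda>s. f s - \<kappa> * s\<^sup>2) has_real_derivative f' - 2 * r * \<kappa>) (at r)"
    by (auto intro!: derivative_eq_intros f)
  have pos: "0 < f' - 2 * r * \<kappa>" using \<kappa> by simp
  obtain d1 where d1: "d1 > 0" "\<And>h. 0 < h \<Longrightarrow> h < d1 \<Longrightarrow> f r - \<kappa> * r\<^sup>2 < f (r + h) - \<kappa> * (r + h)\<^sup>2"
    using DERIV_pos_inc_right[OF h pos] by auto
  obtain d2 where d2: "d2 > 0" "\<And>h. 0 < h \<Longrightarrow> h < d2 \<Longrightarrow> f (r - h) - \<kappa> * (r - h)\<^sup>2 < f r - \<kappa> * r\<^sup>2"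
    using DERIV_pos_inc_left[OF h pos] by auto
  show ?thesis
  proof (intro exI[of _ "min d1 d2"] conjI allI impI)
    fix s assume s: "\<bar>s - r\<bar> < min d1 d2"
    show "\<kappa> * (s\<^sup>2 - r\<^sup>2) \<le> f s - f r" if "r < s"
      using d1(2)[of "s - r"] s that by (simp add: right_diff_distrib)
    show "f s - f r \<le> \<kappa> * (s\<^sup>2 - r\<^sup>2)" if "s < r"
      using d2(2)[of "r - s"] s that by (simp add: right_diff_distrib)
  qed (use d1 d2 in simp)
qed

text \<open>The difference \<open>E\<close> of the two sides has derivative
  \<open>s * (w s - w0 - \<kappa> * (s\<^sup>2 - r\<^sup>2))\<close>, so it is minimal at
  \<open>r\<close>. The number \<open>w0\<close> may differ from \<open>w r\<close>; at
  \<open>r = 0\<close>, where there is no left side, a perturbed value is inserted.\<close>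

lemma primitive_ge_parabola:
  fixes w I :: "real \<Rightarrow> real"
  assumes dI: "\<And>s. 0 < s \<Longrightarrow> s < \<rho> \<Longrightarrow> (I has_real_derivative s * w s) (at s)"
    and cI: "continuous_on {0..<\<rho>} I" and r: "0 \<le> r" "r < \<rho>"
    and right: "\<And>s. r < s \<Longrightarrow> s < \<rho> \<Longrightarrow> \<bar>s - r\<bar> < d \<Longrightarrow> \<kappa> * (s\<^sup>2 - r\<^sup>2) \<le> w s - w0"
    and left: "\<And>s. 0 < s \<Longrightarrow> s < r \<Longrightarrow> \<bar>s - r\<bar> < d \<Longrightarrow> w s - w0 \<le> \<kappa> * (s\<^sup>2 - r\<^sup>2)"
    and s: "0 \<le> s" "s < \<rho>" "\<bar>s - r\<bar> < d"
  shows "w0 / 2 * (s\<^sup>2 - r\<^sup>2) + \<kappa> / 4 * (s\<^sup>2 - r\<^sup>2)\<^sup>2 \<le> I s - I r"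
proof -
  define E where "E s = I s - (w0 / 2 * (s\<^sup>2 - r\<^sup>2) + \<kappa> / 4 * (s\<^sup>2 - r\<^sup>2)\<^sup>2)" for s
  have dE: "(E has_real_derivative s * (w s - w0 - \<kappa> * (s\<^sup>2 - r\<^sup>2))) (at s)" if "0 < s" "s < \<rho>" for s
    unfolding E_def by (auto intro!: derivative_eq_intros dI[OF that] simp: algebra_simps power2_eq_square)
  have cE: "continuous_on {a..c} E" if "0 \<le> a" "c < \<rho>" for a c
    unfolding E_def by (intro continuous_intros continuous_on_subset[OF cI]) (use that in auto)
  have "E r \<le> E s"
  proof (cases "r \<le> s")
    case True
    show ?thesis
    proof (rule DERIV_nonneg_imp_increasing_open[OF True])
      fix x assume x: "r < x" "x < s"
      have "0 \<le> x * (w x - w0 - \<kappa> * (x\<^sup>2 - r\<^sup>2))"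
        using right[of x] x r s by (intro mult_nonneg_nonneg) auto
      then show "\<exists>y. (E has_real_derivative y) (at x) \<and> 0 \<le> y"
        using dE[of x] x r s by auto
    qed (use cE r s in auto)
  next
    case False
    then have "s \<le> r" by simp
    then show ?thesis
    proof (rule DERIV_nonpos_imp_decreasing_open)
      fix x assume x: "s < x" "x < r"
      have "x * (w x - w0 - \<kappa> * (x\<^sup>2 - r\<^sup>2)) \<le> 0"
        using left[of x] x r s by (intro mult_nonneg_nonpos) auto
      then show "\<exists>y. (E has_real_derivative y) (at x) \<and> y \<le> 0"
        using dE[of x] x r s by auto
    qed (use cE r s in auto)
  qed
  then show ?thesis by (simp add: E_def)
qed

text \<open>\<open>\<rho>\<close> will be the critical radius. Keeping \<open>R\<close> as well
  allows \<open>W\<close> to be studied on the closed interval up to \<open>R\<close>, while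
  \<open>g\<close>, which may blow up at \<open>\<rho>\<close>, is used only below
  \<open>\<rho>\<close>.\<close>

locale radial_drift =
  fixes k :: nat and b :: "real \<Rightarrow> real" and r0 \<rho> R :: real
  assumes k: "1 \<le> k" and \<rho>: "0 < \<rho>" "\<rho> \<le> R" and r0: "0 \<le> r0"
    and cont_b: "continuous_on {0..R} b"
    and diff_b: "\<And>r. 0 < r \<Longrightarrow> r < R \<Longrightarrow> b differentiable (at r)"
    and sign: "\<And>r. 0 < r \<Longrightarrow> r < R \<Longrightarrow> 0 \<le> (r - r0) * deriv (\<lambda>s. s * b s) r"
    and below: "\<And>r. 0 \<le> r \<Longrightarrow> r < \<rho> \<Longrightarrow> r * b r < real k"
begin

definition g where "g r = 1 / (real k - r * b r)"
definition g' where "g' r = deriv (\<lambda>s. s * b s) r / (real k - r * b r)\<^sup>2"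
definition B where "B r = integral {0..r} b"
definition M where "M r = r ^ k * exp (- B r)"
text \<open>The integrand is \<open>M s / s\<close>, so \<open>N / M\<close> is the
  variation-of-constants solution of the linear equation that stays bounded at 0. The clause for
  \<open>r \<le> 0\<close> in \<open>W\<close> supplies its limit, and \<open>W'\<close> is read off
  from the equation.\<close>

definition N where "N r = integral {0..r} (\<lambda>s. s ^ (k - 1) * exp (- B s))"
definition W where "W r = (if r \<le> 0 then 1 / real k else N r / M r)"
definition W' where "W' r = (1 - (real k - r * b r) * W r) / r"
definition w where "w r = max (W r) (g r)"
definition I where "I r = integral {0..r} (\<lambda>s. s * w s)"

lemma has_derivative_integral_from_0:
  fixes f :: "real \<Rightarrow> real"
  assumes "continuous_on {0..c} f" "0 < r" "r < c"
  shows "((\<lambda>r. integral {0..r} f) has_real_derivative f r) (at r)"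
  using integral_has_real_derivative[OF assms(1), of r] assms(2,3)
  by (simp add: at_within_Icc_at)

lemma continuous_on_B: "continuous_on {0..R} B"
  unfolding B_def by (rule indefinite_integral_continuous_1) (rule integrable_continuous_real[OF cont_b])

lemma DERIV_B: "0 < r \<Longrightarrow> r < R \<Longrightarrow> (B has_real_derivative b r) (at r)"
  unfolding B_def by (rule has_derivative_integral_from_0[OF cont_b])

lemma continuous_on_integrand: "continuous_on {0..R} (\<lambda>s. s ^ (k - 1) * exp (- B s))"
  by (intro continuous_intros continuous_on_B)

lemma continuous_on_N: "continuous_on {0..R} N"
  unfolding N_def by (rule indefinite_integral_continuous_1) (rule integrable_continuous_real[OF continuous_on_integrand])

lemma DERIV_N: "0 < r \<Longrightarrow> r < R \<Longrightarrow> (N has_real_derivative r ^ (k - 1) * exp (- B r)) (at r)"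
  unfolding N_def by (rule has_derivative_integral_from_0[OF continuous_on_integrand])

lemma continuous_on_M: "continuous_on {0..R} M"
  unfolding M_def by (intro continuous_intros continuous_on_B)

lemma M_pos: "0 < r \<Longrightarrow> 0 < M r"
  by (simp add: M_def)

lemma M_split: "M r = r * (r ^ (k - 1) * exp (- B r))"
  using k power_minus_mult[of k r] by (simp add: M_def mult.commute)

lemma DERIV_M:
  assumes r: "0 < r" "r < R"
  shows "(M has_real_derivative r ^ (k - 1) * exp (- B r) * (real k - r * b r)) (at r)"
proof -
  have "r ^ k = r * r ^ (k - 1)" using k by (cases k) auto
  then show ?thesis
    unfolding M_def by (auto intro!: derivative_eq_intros DERIV_B[OF r] simp: algebra_simps)
qed

lemma DERIV_W:
  assumes r: "0 < r" "r < R"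
  shows "(W has_real_derivative W' r) (at r)"
proof -
  have "((\<lambda>r. N r / M r) has_real_derivative W' r) (at r)"
  proof (rule DERIV_cong[OF DERIV_divide[OF DERIV_N[OF r] DERIV_M[OF r]]])
    show "M r \<noteq> 0" using M_pos[OF r(1)] by simp
    let ?p = "r ^ (k - 1) * exp (- B r)"
    have p: "?p \<noteq> 0" using r by simp
    have "(?p * (r * ?p) - N r * (?p * (real k - r * b r))) / (r * ?p * (r * ?p))
        = (1 - (real k - r * b r) * (N r / (r * ?p))) / r"
      using p r by (simp add: field_simps)
    then show "(?p * M r - N r * (?p * (real k - r * b r))) / (M r * M r) = W' r"
      unfolding W'_def W_def M_split using r by simp
  qed
  then show ?thesis
    by (rule DERIV_cong_ev[THEN iffD1, OF refl _ refl, rotated])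
      (use r in \<open>auto simp: W_def eventually_nhds_metric dist_real_def intro!: exI[of _ r]\<close>)
qed

lemma g_pos: "0 \<le> r \<Longrightarrow> r < \<rho> \<Longrightarrow> 0 < g r"
  using below by (simp add: g_def)

lemma g_cancel: "0 \<le> r \<Longrightarrow> r < \<rho> \<Longrightarrow> (real k - r * b r) * g r = 1"
  using below[of r] by (simp add: g_def)

lemma continuous_on_g: "continuous_on {0..<\<rho>} g"
  unfolding g_def
  by (intro continuous_intros continuous_on_subset[OF cont_b]) (use \<rho> below in force)+

lemma DERIV_rb:
  assumes r: "0 < r" "r < R"
  shows "((\<lambda>s. s * b s) has_real_derivative deriv (\<lambda>s. s * b s) r) (at r)"
proof -
  have "(\<lambda>s. s * b s) differentiable (at r)"
    by (intro differentiable_mult differentiable_ident diff_b[OF r])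
  then show ?thesis using DERIV_deriv_iff_real_differentiable by blast
qed

lemma DERIV_g:
  assumes r: "0 < r" "r < \<rho>"
  shows "(g has_real_derivative g' r) (at r)"
proof -
  have "real k - r * b r \<noteq> 0" using below[of r] r by simp
  moreover have "((\<lambda>s. 1 / (real k - f s)) has_real_derivative f' / (real k - f r)\<^sup>2) (at r)"
    if "(f has_real_derivative f') (at r)" "real k - f r \<noteq> 0" for f f'
    by (auto intro!: derivative_eq_intros that simp: power2_eq_square)
  ultimately show ?thesis
    unfolding g_def g'_def using DERIV_rb[of r] r \<rho> by simp
qed

text \<open>L'Hopital's rule: the quotient of the derivatives of \<open>N\<close> and
  \<open>M\<close> is \<open>g\<close>, and \<open>r * b r\<close> vanishes at 0.\<close>

lemma W_tendsto: "(W \<longlongrightarrow> 1 / real k) (at_right 0)"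
proof -
  have ev: "\<forall>\<^sub>F r in at_right 0. 0 < r \<and> r < R"
    using \<rho> by (auto simp: eventually_at_right_field intro!: exI[of _ R])
  have 0: "at 0 within {0..R} = at_right 0"
    using \<rho> by (simp add: at_within_Icc_at_right)
  have "(N \<longlongrightarrow> N 0) (at_right 0)" "(M \<longlongrightarrow> M 0) (at_right 0)"
    using continuous_on_N continuous_on_M \<rho> unfolding continuous_on_def 0[symmetric] by auto
  moreover have "N 0 = 0" "M 0 = 0" using k by (simp_all add: N_def M_def)
  ultimately have lim: "(N \<longlongrightarrow> 0) (at_right 0)" "(M \<longlongrightarrow> 0) (at_right 0)" by simp_all
  have "((\<lambda>r. N r / M r) \<longlongrightarrow> 1 / real k) (at_right 0)"
  proof (rule lhopital_right[OF lim])
    show "\<forall>\<^sub>F r in at_right 0. M r \<noteq> 0"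
      using ev by eventually_elim (metis M_pos less_irrefl)
    show "\<forall>\<^sub>F r in at_right 0. (N has_real_derivative r ^ (k - 1) * exp (- B r)) (at r)"
      using ev by eventually_elim (blast intro: DERIV_N)
    show "\<forall>\<^sub>F r in at_right 0. (M has_real_derivative r ^ (k - 1) * exp (- B r) * (real k - r * b r)) (at r)"
      using ev by eventually_elim (blast intro: DERIV_M)
    have ev\<rho>: "\<forall>\<^sub>F r in at_right 0. 0 < r \<and> r < \<rho>"
      using \<rho> by (auto simp: eventually_at_right_field intro!: exI[of _ \<rho>])
    show "\<forall>\<^sub>F r in at_right 0. r ^ (k - 1) * exp (- B r) * (real k - r * b r) \<noteq> 0"
      using ev\<rho>
    proof eventually_elim
      case (elim r)
      then show ?case using below[of r] by simp
    qed
    have "(b \<longlongrightarrow> b 0) (at_right 0)"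
      using cont_b \<rho> unfolding continuous_on_def 0[symmetric] by auto
    then have "((\<lambda>r. 1 / (real k - r * b r)) \<longlongrightarrow> 1 / (real k - 0 * b 0)) (at_right 0)"
      by (intro tendsto_intros) (use k in auto)
    then have "((\<lambda>r. 1 / (real k - r * b r)) \<longlongrightarrow> 1 / real k) (at_right 0)" by simp
    then show "((\<lambda>r. r ^ (k - 1) * exp (- B r) / (r ^ (k - 1) * exp (- B r) * (real k - r * b r)))
        \<longlongrightarrow> 1 / real k) (at_right 0)"
      by (rule Lim_transform_eventually) (use ev\<rho> in \<open>eventually_elim, auto\<close>)
  qed
  then show ?thesis
    by (rule Lim_transform_eventually) (use ev in \<open>eventually_elim, auto simp: W_def\<close>)
qed

lemma continuous_on_W: "continuous_on {0..R} W"
  unfolding continuous_on_def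
proof
  fix r assume r: "r \<in> {0..R}"
  show "(W \<longlongrightarrow> W r) (at r within {0..R})"
  proof (cases "r = 0")
    case True
    then show ?thesis using W_tendsto \<rho> by (simp add: at_within_Icc_at_right W_def)
  next
    case False
    then have r: "0 < r" "r \<le> R" using r by auto
    have "((\<lambda>r. N r / M r) \<longlongrightarrow> N r / M r) (at r within {0..R})"
      using continuous_on_N continuous_on_M r M_pos[OF r(1)] unfolding continuous_on_def
      by (intro tendsto_divide) auto
    moreover have "\<forall>\<^sub>F s in at r within {0..R}. N s / M s = W s"
      using r by (auto simp: W_def eventually_at dist_real_def intro!: exI[of _ r])
    ultimately show ?thesis
      using r Lim_transform_eventually by (fastforce simp: W_def)
  qed
qed

section \<open>The order of \<open>W\<close> and \<open>g\<close>\<close>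

definition D where "D r = N r - M r * g r"

lemma DERIV_D:
  assumes r: "0 < r" "r < \<rho>"
  shows "(D has_real_derivative - (M r * g' r)) (at r)"
proof -
  have "r < R" using r \<rho> by simp
  note d = DERIV_diff[OF DERIV_N[OF r(1) this] DERIV_mult[OF DERIV_M[OF r(1) this] DERIV_g[OF r]]]
  have "r ^ (k - 1) * exp (- B r) * (real k - r * b r) * g r = r ^ (k - 1) * exp (- B r)"
    using g_cancel[of r] r by (simp add: mult.assoc)
  then show ?thesis
    unfolding D_def using d by (auto intro!: DERIV_cong[OF d])
qed

lemma continuous_on_D: "continuous_on {0..<\<rho>} D"
  unfolding D_def
  by (intro continuous_intros continuous_on_g continuous_on_subset[OF continuous_on_N]
      continuous_on_subset[OF continuous_on_M]) (use \<rho> in auto)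

lemma g'_sign:
  assumes "0 < r" "r < \<rho>"
  shows "r < r0 \<Longrightarrow> g' r \<le> 0" "r0 < r \<Longrightarrow> 0 \<le> g' r"
  using sign[of r] assms \<rho>
  by (auto simp: g'_def zero_le_mult_iff divide_nonpos_nonneg)

lemma D_nonneg:
  assumes "0 \<le> r" "r < \<rho>" "r \<le> r0"
  shows "0 \<le> D r"
proof -
  have "D 0 \<le> D r"
  proof (rule DERIV_nonneg_imp_increasing_open[OF assms(1)])
    fix x assume x: "0 < x" "x < r"
    then have "M x * g' x \<le> 0"
      using g'_sign(1)[of x] M_pos[of x] assms by (simp add: mult_nonneg_nonpos)
    then show "\<exists>y. (D has_real_derivative y) (at x) \<and> 0 \<le> y"
      using DERIV_D[of x] x assms by auto
  qed (rule continuous_on_subset[OF continuous_on_D], use assms in auto)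
  moreover have "D 0 = 0" using k by (simp add: D_def N_def M_def)
  ultimately show ?thesis by simp
qed

lemma D_decreasing:
  assumes "r0 \<le> s" "s \<le> r" "r < \<rho>"
  shows "D r \<le> D s"
proof (rule DERIV_nonpos_imp_decreasing_open[OF assms(2)])
  fix x assume x: "s < x" "x < r"
  then have "0 \<le> M x * g' x"
    using g'_sign(2)[of x] M_pos[of x] assms r0 by simp
  then show "\<exists>y. (D has_real_derivative y) (at x) \<and> y \<le> 0"
    using DERIV_D[of x] x assms r0 by auto
qed (rule continuous_on_subset[OF continuous_on_D], use assms r0 in auto)

lemma g_le_W_iff: "0 < r \<Longrightarrow> g r \<le> W r \<longleftrightarrow> 0 \<le> D r"
  using M_pos[of r] by (simp add: W_def D_def field_simps)

text \<open>\<open>D\<close> is nonnegative up to \<open>r0\<close> and nonincreasing afterwards, so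
  the set where \<open>W\<close> dominates is an initial interval. In particular
  \<open>w = W\<close> to the left of a switching point.\<close>

lemma g_le_W_downward:
  assumes "g r \<le> W r" "0 < s" "s \<le> r" "r < \<rho>"
  shows "g s \<le> W s"
proof (cases "s \<le> r0")
  case True
  then show ?thesis using D_nonneg[of s] g_le_W_iff[of s] assms by simp
next
  case False
  then have "D r \<le> D s" using D_decreasing assms by simp
  then show ?thesis using g_le_W_iff[of s] g_le_W_iff[of r] assms by simp
qed

lemma r0_less_if_W_less: "0 < r \<Longrightarrow> r < \<rho> \<Longrightarrow> W r < g r \<Longrightarrow> r0 < r"
  using D_nonneg[of r] g_le_W_iff[of r] by force

lemma continuous_on_w: "continuous_on {0..<\<rho>} w"
  unfolding w_def
  by (intro continuous_intros continuous_on_g continuous_on_subset[OF continuous_on_W]) (use \<rho> in auto)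

lemma w_0: "w 0 = 1 / real k"
  by (simp add: w_def W_def g_def)

lemma DERIV_I:
  assumes "0 < r" "r < \<rho>"
  shows "(I has_real_derivative r * w r) (at r)"
  unfolding I_def
  by (rule has_derivative_integral_from_0[of "(r + \<rho>) / 2" "\<lambda>s. s * w s"])
    (use assms in \<open>auto intro!: continuous_intros continuous_on_subset[OF continuous_on_w]\<close>)

lemma continuous_on_I: "continuous_on {0..<\<rho>} I"
  unfolding continuous_on_eq_continuous_within
proof
  fix r assume r: "r \<in> {0..<\<rho>}"
  define c where "c = (r + \<rho>) / 2"
  have c: "r < c" "c < \<rho>" unfolding c_def using r by auto
  have "continuous_on {0..c} I"
    unfolding I_def
    by (rule indefinite_integral_continuous_1, rule integrable_continuous_real)
      (use c in \<open>auto intro!: continuous_intros continuous_on_subset[OF continuous_on_w]\<close>)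
  then have "continuous (at r within {0..c}) I"
    using r c by (auto simp: continuous_on_eq_continuous_within)
  moreover have "at r within {0..c} = at r within {0..<\<rho>}"
    by (rule at_within_nhd[of _ "{..<c}"]) (use c r in auto)
  ultimately show "continuous (at r within {0..<\<rho>}) I" by (simp add: continuous_within)
qed

lemma I_mono:
  assumes "0 \<le> s" "s \<le> r" "r < \<rho>"
  shows "I s \<le> I r"
proof (rule DERIV_nonneg_imp_increasing_open[OF assms(2)])
  fix x assume x: "s < x" "x < r"
  then have "0 \<le> x * w x" using g_pos[of x] assms by (auto simp: w_def le_max_iff_disj)
  then show "\<exists>y. (I has_real_derivative y) (at x) \<and> 0 \<le> y"
    using DERIV_I[of x] x assms by auto
qed (rule continuous_on_subset[OF continuous_on_I], use assms in auto)


text \<open>Touching \<open>- I\<close> from above amounts to bounding \<open>w\<close> by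
  \<open>w0 + \<kappa> * (s\<^sup>2 - r\<^sup>2)\<close> from below on the right of \<open>r\<close>
  and from above on the left. For \<open>w0 \<ge> 0\<close> the operator on the resulting quartic is
  \<open>- (k - r * b r) * w0 + 2 * r\<^sup>2 * max (- \<kappa>) 0\<close>.\<close>

lemma upper_jet:
  assumes r: "0 \<le> r" "r < \<rho>" and \<delta>: "0 < \<delta>"
  shows "\<exists>\<beta> \<gamma>. jet_operator k b r \<beta> \<gamma> \<le> -1 + \<delta> \<and> (\<exists>d>0. \<forall>s. 0 \<le> s \<and> s < \<rho> \<and> \<bar>s - r\<bar> < d \<longrightarrow>
    - I s \<le> - I r + \<beta> * (s\<^sup>2 - r\<^sup>2) + \<gamma> * (s\<^sup>2 - r\<^sup>2)\<^sup>2)"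
proof -
  have "\<exists>w0 \<kappa>. jet_operator k b r (- w0 / 2) (- \<kappa> / 4) \<le> -1 + \<delta> \<and>
    (\<exists>d>0. \<forall>s. s < \<rho> \<and> \<bar>s - r\<bar> < d \<longrightarrow> (r < s \<longrightarrow> \<kappa> * (s\<^sup>2 - r\<^sup>2) \<le> w s - w0)
      \<and> (0 < s \<and> s < r \<longrightarrow> w s - w0 \<le> \<kappa> * (s\<^sup>2 - r\<^sup>2)))"
  proof (cases "r = 0")
    case True
    have pos: "0 < \<delta> / real k" using \<delta> k by simp
    then obtain d where d: "d > 0" "\<And>s. s \<in> {0..<\<rho>} \<Longrightarrow> dist s 0 < d \<Longrightarrow> dist (w s) (w 0) < \<delta> / real k"
      using continuous_on_w \<rho> unfolding continuous_on_iff by (metis atLeastLessThan_iff order_refl)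
    \<comment> \<open>Only continuity of \<open>w\<close> is used at the origin. The operator there
      is \<open>- k * w0\<close>, so lowering \<open>w0\<close> by \<open>\<delta> / k\<close> costs
      exactly \<open>\<delta>\<close>.\<close>
    have "jet_operator k b r (- (w 0 - \<delta> / real k) / 2) (- 0 / 4) \<le> -1 + \<delta>"
      using k by (simp add: jet_operator_def True w_0 field_simps)
    moreover have "0 * (s\<^sup>2 - r\<^sup>2) \<le> w s - (w 0 - \<delta> / real k)" if "s < \<rho>" "\<bar>s - r\<bar> < d" "r < s" for s
      using d(2)[of s] that True by (auto simp: dist_real_def abs_less_iff)
    ultimately show ?thesis
      using True d(1) by (intro exI[of _ "w 0 - \<delta> / real k"] exI[of _ 0]) auto
  next
    case False
    then have r: "0 < r" "r < \<rho>" "r < R" using r \<rho> by auto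
    \<comment> \<open>Lowering \<open>\<kappa>\<close> by \<open>\<delta>'\<close> raises the
      operator by at most \<open>2 * r\<^sup>2 * \<delta>' = \<delta>\<close>.\<close>
    define \<delta>' where "\<delta>' = \<delta> / (2 * r\<^sup>2)"
    have \<delta>': "0 < \<delta>'" "2 * r\<^sup>2 * \<delta>' = \<delta>" unfolding \<delta>'_def using \<delta> r by auto
    show ?thesis
    proof (cases "g r \<le> W r")
      case True
      \<comment> \<open>At a switching point \<open>w\<close> may have a corner, but the slope of
        \<open>W\<close> is enough: on the left \<open>w = W\<close>, and on the right only a lower
        bound is wanted, which \<open>w \<ge> W\<close> provides.\<close>
      define \<kappa> where "\<kappa> = W' r / (2 * r) - \<delta>'"
      have "2 * r * \<kappa> < W' r" unfolding \<kappa>_def using r \<delta>' by (simp add: field_simps)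
      from derivative_above_parabola[OF DERIV_W[OF r(1,3)] this] obtain d where d: "d > 0"
        "\<And>s. \<bar>s - r\<bar> < d \<Longrightarrow> (r < s \<longrightarrow> \<kappa> * (s\<^sup>2 - r\<^sup>2) \<le> W s - W r) \<and> (s < r \<longrightarrow> W s - W r \<le> \<kappa> * (s\<^sup>2 - r\<^sup>2))"
        by blast
      have ws: "w s = W s" if "0 < s" "s < r" for s
        using g_le_W_downward[OF True, of s] that r by (simp add: w_def)
      have Wpos: "0 < W r" using True g_pos[of r] r by simp
      have "1 \<le> (real k - r * b r) * W r"
        using mult_left_mono[OF True, of "real k - r * b r"] g_cancel[of r] below[of r] r by simp
      then have W'neg: "W' r \<le> 0" unfolding W'_def using r by (simp add: divide_le_0_iff)
      then have "W' r / (2 * r) \<le> 0" using r by (simp add: divide_nonpos_pos)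
      then have "\<kappa> \<le> 0" unfolding \<kappa>_def using \<delta>' by simp
      then have m: "max (- \<kappa> / 4) 0 = - \<kappa> / 4" by simp
      have "8 * r\<^sup>2 * (- \<kappa> / 4) = 2 * r\<^sup>2 * \<delta>' - r * W' r"
        unfolding \<kappa>_def using r by (simp add: field_simps power2_eq_square)
      moreover have "r * W' r = 1 - (real k - r * b r) * W r" unfolding W'_def using r by simp
      ultimately have "jet_operator k b r (- W r / 2) (- \<kappa> / 4) \<le> -1 + \<delta>"
        unfolding jet_operator_def m using Wpos \<delta>'(2) by (simp add: algebra_simps)
      moreover have "(r < s \<longrightarrow> \<kappa> * (s\<^sup>2 - r\<^sup>2) \<le> w s - W r) \<and> (0 < s \<and> s < r \<longrightarrow> w s - W r \<le> \<kappa> * (s\<^sup>2 - r\<^sup>2))"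
        if "\<bar>s - r\<bar> < d" for s
      proof -
        have "W s \<le> w s" by (simp add: w_def)
        then show ?thesis using d(2)[OF that] ws[of s] by auto
      qed
      ultimately show ?thesis using d(1) by blast
    next
      case False
      then have Wg: "W r < g r" by simp
      have r0r: "r0 < r" using r0_less_if_W_less[OF r(1,2) Wg] .
      \<comment> \<open>Beyond \<open>r0\<close> the slope \<open>g' r\<close> is nonnegative, so
        \<open>- \<kappa> \<le> \<delta>'\<close>: the \<open>max\<close> term contributes no more
        than the error, and \<open>(k - r * b r) * g r = 1\<close> gives the rest.\<close>
      define \<kappa> where "\<kappa> = g' r / (2 * r) - \<delta>'"
      have "2 * r * \<kappa> < g' r" unfolding \<kappa>_def using r \<delta>' by (simp add: field_simps)
      from derivative_above_parabola[OF DERIV_g[OF r(1,2)] this] obtain d where d: "d > 0"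
        "\<And>s. \<bar>s - r\<bar> < d \<Longrightarrow> (r < s \<longrightarrow> \<kappa> * (s\<^sup>2 - r\<^sup>2) \<le> g s - g r) \<and> (s < r \<longrightarrow> g s - g r \<le> \<kappa> * (s\<^sup>2 - r\<^sup>2))"
        by blast
      obtain e where e: "e > 0" "\<And>s. \<bar>s - r\<bar> < e \<Longrightarrow> W s < g s"
      proof -
        have "isCont (\<lambda>s. g s - W s) r"
          using DERIV_isCont[OF DERIV_g[OF r(1,2)]] DERIV_isCont[OF DERIV_W[OF r(1,3)]] by simp
        then have "\<forall>\<^sub>F s in nhds r. 0 < g s - W s"
          using Wg by (intro order_tendstoD) (auto simp: isCont_def tendsto_nhds_iff)
        then show ?thesis using that unfolding eventually_nhds_metric dist_real_def by auto
      qed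
      have gpos: "0 < g r" using g_pos r by simp
      have "0 \<le> g' r" using g'_sign(2)[OF r(1,2) r0r] .
      then have "0 \<le> g' r / (2 * r)" using r by simp
      then have "max (- \<kappa> / 4) 0 \<le> \<delta>' / 4"
        unfolding \<kappa>_def using \<delta>'(1) by (intro max.boundedI) auto
      then have "8 * r\<^sup>2 * max (- \<kappa> / 4) 0 \<le> 8 * r\<^sup>2 * (\<delta>' / 4)" by (intro mult_left_mono) auto
      also have "\<dots> = 2 * r\<^sup>2 * \<delta>'" by simp
      also have "\<dots> = \<delta>" by (rule \<delta>'(2))
      finally have "8 * r\<^sup>2 * max (- \<kappa> / 4) 0 \<le> \<delta>" .
      moreover have "(real k - r * b r) * g r = 1" using g_cancel r by simp
      ultimately have "jet_operator k b r (- g r / 2) (- \<kappa> / 4) \<le> -1 + \<delta>"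
        unfolding jet_operator_def using gpos by (simp add: algebra_simps)
      moreover have "(r < s \<longrightarrow> \<kappa> * (s\<^sup>2 - r\<^sup>2) \<le> w s - g r) \<and> (0 < s \<and> s < r \<longrightarrow> w s - g r \<le> \<kappa> * (s\<^sup>2 - r\<^sup>2))"
        if "\<bar>s - r\<bar> < min d e" for s
        using d(2)[of s] e(2)[of s] that by (auto simp: w_def)
      ultimately show ?thesis using d(1) e(1) by (metis min_less_iff_conj)
    qed
  qed
  then obtain w0 \<kappa> d where j: "jet_operator k b r (- w0 / 2) (- \<kappa> / 4) \<le> -1 + \<delta>" "0 < d"
    "\<And>s. s < \<rho> \<Longrightarrow> \<bar>s - r\<bar> < d \<Longrightarrow> r < s \<Longrightarrow> \<kappa> * (s\<^sup>2 - r\<^sup>2) \<le> w s - w0"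
    "\<And>s. s < \<rho> \<Longrightarrow> \<bar>s - r\<bar> < d \<Longrightarrow> 0 < s \<Longrightarrow> s < r \<Longrightarrow> w s - w0 \<le> \<kappa> * (s\<^sup>2 - r\<^sup>2)"
    by blast
  have "- I s \<le> - I r + (- w0 / 2) * (s\<^sup>2 - r\<^sup>2) + (- \<kappa> / 4) * (s\<^sup>2 - r\<^sup>2)\<^sup>2"
    if "0 \<le> s" "s < \<rho>" "\<bar>s - r\<bar> < d" for s
    using primitive_ge_parabola[OF DERIV_I continuous_on_I r, of d \<kappa> w0 s] j(3,4) that r by force
  then show ?thesis using j(1,2) by blast
qed

text \<open>The \<open>max\<close> term now helps. Where \<open>w r = g r\<close>, the identity
  \<open>(k - r * b r) * g r = 1\<close> already gives the inequality, and \<open>\<kappa>\<close>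
  may be as negative as the one-sided bounds require; where \<open>W\<close> dominates strictly,
  \<open>w = W\<close> nearby.\<close>

lemma lower_jet:
  assumes r: "0 \<le> r" "r < \<rho>" and \<delta>: "0 < \<delta>"
  shows "\<exists>\<beta> \<gamma>. jet_operator k b r \<beta> \<gamma> \<ge> -1 - \<delta> \<and> (\<exists>d>0. \<forall>s. 0 \<le> s \<and> s < \<rho> \<and> \<bar>s - r\<bar> < d \<longrightarrow>
    - I s \<ge> - I r + \<beta> * (s\<^sup>2 - r\<^sup>2) + \<gamma> * (s\<^sup>2 - r\<^sup>2)\<^sup>2)"
proof -
  have "\<exists>w0 \<kappa>. jet_operator k b r (w0 / 2) (\<kappa> / 4) \<ge> -1 - \<delta> \<and>
    (\<exists>d>0. \<forall>s. s < \<rho> \<and> \<bar>s - r\<bar> < d \<longrightarrow> (r < s \<longrightarrow> \<kappa> * (s\<^sup>2 - r\<^sup>2) \<le> - w s - w0)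
      \<and> (0 < s \<and> s < r \<longrightarrow> - w s - w0 \<le> \<kappa> * (s\<^sup>2 - r\<^sup>2)))"
  proof (cases "r = 0")
    case True
    have pos: "0 < \<delta> / real k" using \<delta> k by simp
    then obtain d where d: "d > 0" "\<And>s. s \<in> {0..<\<rho>} \<Longrightarrow> dist s 0 < d \<Longrightarrow> dist (w s) (w 0) < \<delta> / real k"
      using continuous_on_w \<rho> unfolding continuous_on_iff by (metis atLeastLessThan_iff order_refl)
    have "jet_operator k b r (- (w 0 + \<delta> / real k) / 2) (0 / 4) \<ge> -1 - \<delta>"
      using k by (simp add: jet_operator_def True w_0 field_simps)
    moreover have "0 * (s\<^sup>2 - r\<^sup>2) \<le> - w s - (- (w 0 + \<delta> / real k))" if "s < \<rho>" "\<bar>s - r\<bar> < d" "r < s" for s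
      using d(2)[of s] that True by (auto simp: dist_real_def abs_less_iff)
    ultimately show ?thesis
      using True d(1) by (intro exI[of _ "- (w 0 + \<delta> / real k)"] exI[of _ 0]) auto
  next
    case False
    then have r: "0 < r" "r < \<rho>" "r < R" using r \<rho> by auto
    define \<delta>' where "\<delta>' = \<delta> / (2 * r\<^sup>2)"
    have \<delta>': "0 < \<delta>'" "2 * r\<^sup>2 * \<delta>' = \<delta>" unfolding \<delta>'_def using \<delta> r by auto
    have dW: "((\<lambda>s. - W s) has_real_derivative - W' r) (at r)"
      using DERIV_W[OF r(1,3)] by (rule DERIV_minus)
    have dg: "((\<lambda>s. - g s) has_real_derivative - g' r) (at r)"
      using DERIV_g[OF r(1,2)] by (rule DERIV_minus)
    show ?thesis
    proof (cases "g r < W r")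
      case True
      define \<kappa> where "\<kappa> = - W' r / (2 * r) - \<delta>'"
      have "2 * r * \<kappa> < - W' r" unfolding \<kappa>_def using r \<delta>' by (simp add: field_simps)
      from derivative_above_parabola[OF dW this] obtain d where d: "d > 0"
        "\<And>s. \<bar>s - r\<bar> < d \<Longrightarrow> (r < s \<longrightarrow> \<kappa> * (s\<^sup>2 - r\<^sup>2) \<le> - W s - - W r) \<and> (s < r \<longrightarrow> - W s - - W r \<le> \<kappa> * (s\<^sup>2 - r\<^sup>2))"
        by blast
      obtain e where e: "e > 0" "\<And>s. \<bar>s - r\<bar> < e \<Longrightarrow> g s < W s"
      proof -
        have "isCont (\<lambda>s. W s - g s) r"
          using DERIV_isCont[OF DERIV_g[OF r(1,2)]] DERIV_isCont[OF DERIV_W[OF r(1,3)]] by simp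
        then have "\<forall>\<^sub>F s in nhds r. 0 < W s - g s"
          using True by (intro order_tendstoD) (auto simp: isCont_def tendsto_nhds_iff)
        then show ?thesis using that unfolding eventually_nhds_metric dist_real_def by auto
      qed
      have Wpos: "0 < W r" using True g_pos[of r] r by simp
      have "8 * r\<^sup>2 * (\<kappa> / 4) \<le> 8 * r\<^sup>2 * max (\<kappa> / 4) 0" by (intro mult_left_mono) auto
      moreover have "8 * r\<^sup>2 * (\<kappa> / 4) = - (2 * r\<^sup>2 * \<delta>') - r * W' r"
        unfolding \<kappa>_def using r by (simp add: field_simps power2_eq_square)
      moreover have "r * W' r = 1 - (real k - r * b r) * W r" unfolding W'_def using r by simp
      ultimately have "jet_operator k b r (- W r / 2) (\<kappa> / 4) \<ge> -1 - \<delta>"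
        unfolding jet_operator_def using Wpos \<delta>'(2) by (simp add: algebra_simps)
      moreover have "(r < s \<longrightarrow> \<kappa> * (s\<^sup>2 - r\<^sup>2) \<le> - w s - - W r) \<and> (0 < s \<and> s < r \<longrightarrow> - w s - - W r \<le> \<kappa> * (s\<^sup>2 - r\<^sup>2))"
        if "\<bar>s - r\<bar> < min d e" for s
        using d(2)[of s] e(2)[of s] that by (auto simp: w_def)
      ultimately show ?thesis using d(1) e(1) by (metis min_less_iff_conj)
    next
      case False
      \<comment> \<open>Strictly below what both slopes \<open>- W' r\<close> and
        \<open>- g' r\<close> allow, because either function may realise the maximum
        \<open>w\<close> near a point where they coincide.\<close>
      define \<kappa> where "\<kappa> = min (- W' r) (min (- g' r) 0) / (2 * r) - 1"
      have \<kappa>: "2 * r * \<kappa> < - W' r" "2 * r * \<kappa> < - g' r"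
      proof -
        have "2 * r * \<kappa> = min (- W' r) (min (- g' r) 0) - 2 * r"
          unfolding \<kappa>_def using r by (simp add: field_simps)
        then show "2 * r * \<kappa> < - W' r" "2 * r * \<kappa> < - g' r" using r by auto
      qed
      from derivative_above_parabola[OF dW \<kappa>(1)] obtain d where d: "d > 0"
        "\<And>s. \<bar>s - r\<bar> < d \<Longrightarrow> (r < s \<longrightarrow> \<kappa> * (s\<^sup>2 - r\<^sup>2) \<le> - W s - - W r) \<and> (s < r \<longrightarrow> - W s - - W r \<le> \<kappa> * (s\<^sup>2 - r\<^sup>2))"
        by blast
      from derivative_above_parabola[OF dg \<kappa>(2)] obtain e where e: "e > 0"
        "\<And>s. \<bar>s - r\<bar> < e \<Longrightarrow> (r < s \<longrightarrow> \<kappa> * (s\<^sup>2 - r\<^sup>2) \<le> - g s - - g r) \<and> (s < r \<longrightarrow> - g s - - g r \<le> \<kappa> * (s\<^sup>2 - r\<^sup>2))"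
        by blast
      have gpos: "0 < g r" using g_pos r by simp
      have m: "0 \<le> r\<^sup>2 * max (\<kappa> / 4) 0" by (rule mult_nonneg_nonneg) simp_all
      have "jet_operator k b r (- g r / 2) (\<kappa> / 4)
          = - ((real k - r * b r) * g r) + 8 * (r\<^sup>2 * max (\<kappa> / 4) 0)"
        unfolding jet_operator_def using gpos by (simp add: algebra_simps)
      also have "(real k - r * b r) * g r = 1" using g_cancel r by simp
      also have "- 1 - \<delta> \<le> - 1 + 8 * (r\<^sup>2 * max (\<kappa> / 4) 0)"
        using \<delta> m by linarith
      finally have "jet_operator k b r (- g r / 2) (\<kappa> / 4) \<ge> -1 - \<delta>" .
      moreover have "(r < s \<longrightarrow> \<kappa> * (s\<^sup>2 - r\<^sup>2) \<le> - w s - - g r) \<and> (0 < s \<and> s < r \<longrightarrow> - w s - - g r \<le> \<kappa> * (s\<^sup>2 - r\<^sup>2))"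
        if "\<bar>s - r\<bar> < min d e" for s
        using d(2)[of s] e(2)[of s] that False by (auto simp: w_def)
      ultimately show ?thesis using d(1) e(1) by (metis min_less_iff_conj)
    qed
  qed
  then obtain w0 \<kappa> d where j: "jet_operator k b r (w0 / 2) (\<kappa> / 4) \<ge> -1 - \<delta>" "0 < d"
    "\<And>s. s < \<rho> \<Longrightarrow> \<bar>s - r\<bar> < d \<Longrightarrow> r < s \<Longrightarrow> \<kappa> * (s\<^sup>2 - r\<^sup>2) \<le> - w s - w0"
    "\<And>s. s < \<rho> \<Longrightarrow> \<bar>s - r\<bar> < d \<Longrightarrow> 0 < s \<Longrightarrow> s < r \<Longrightarrow> - w s - w0 \<le> \<kappa> * (s\<^sup>2 - r\<^sup>2)"
    by blast
  have dI: "((\<lambda>s. - I s) has_real_derivative s * - w s) (at s)" if "0 < s" "s < \<rho>" for s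
    using DERIV_minus[OF DERIV_I[OF that]] by simp
  have cI: "continuous_on {0..<\<rho>} (\<lambda>s. - I s)" by (intro continuous_intros continuous_on_I)
  have "- I s \<ge> - I r + (w0 / 2) * (s\<^sup>2 - r\<^sup>2) + (\<kappa> / 4) * (s\<^sup>2 - r\<^sup>2)\<^sup>2"
    if "0 \<le> s" "s < \<rho>" "\<bar>s - r\<bar> < d" for s
    using primitive_ge_parabola[OF dI cI r, of d \<kappa> w0 s] j(3,4) that r by force
  then show ?thesis using j(1,2) by blast
qed

subsection \<open>Radial solutions and comparison\<close>

lemma upper_jet_radial:
  fixes U :: "real^'n \<Rightarrow> real"
  assumes U: "\<And>y. norm y < \<sigma> \<Longrightarrow> U y = c * (C - I (norm y))" and \<sigma>: "\<sigma> \<le> \<rho>"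
    and c: "0 \<le> c" and x: "norm x < \<sigma>" and \<delta>: "0 < \<delta>"
  shows "\<exists>\<beta> \<gamma>. jet_operator k b (norm x) \<beta> \<gamma> \<le> c * (-1 + \<delta>) \<and>
    (\<forall>\<^sub>F y in nhds x. U y \<le> radial_quartic (U x) \<beta> \<gamma> (x \<bullet> x) y)"
proof -
  obtain \<beta> \<gamma> d where j: "jet_operator k b (norm x) \<beta> \<gamma> \<le> -1 + \<delta>" "d > 0"
    "\<And>s. 0 \<le> s \<Longrightarrow> s < \<rho> \<Longrightarrow> \<bar>s - norm x\<bar> < d \<Longrightarrow>
      - I s \<le> - I (norm x) + \<beta> * (s\<^sup>2 - (norm x)\<^sup>2) + \<gamma> * (s\<^sup>2 - (norm x)\<^sup>2)\<^sup>2"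
    using upper_jet[OF norm_ge_zero order_less_le_trans[OF x \<sigma>] \<delta>] by blast
  have near: "\<forall>\<^sub>F y in nhds x. dist y x < min d (\<sigma> - norm x)"
    using j(2) x unfolding eventually_nhds_metric by (intro exI[of _ "min d (\<sigma> - norm x)"]) auto
  have "\<forall>\<^sub>F y in nhds x. U y \<le> radial_quartic (U x) (c * \<beta>) (c * \<gamma>) (x \<bullet> x) y"
    using near
  proof eventually_elim
    case (elim y)
    have a: "\<bar>norm y - norm x\<bar> \<le> dist y x" by (simp add: dist_norm norm_triangle_ineq3)
    have y: "norm y < \<sigma>" "\<bar>norm y - norm x\<bar> < d" using a elim by auto
    have "c * (- I (norm y)) \<le> c * (- I (norm x) + \<beta> * ((norm y)\<^sup>2 - (norm x)\<^sup>2) + \<gamma> * ((norm y)\<^sup>2 - (norm x)\<^sup>2)\<^sup>2)"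
      by (intro mult_left_mono j(3) c) (use y \<sigma> in auto)
    then show ?case
      unfolding U[OF y(1)] U[OF x] radial_quartic_def dot_square_norm by (simp add: algebra_simps)
  qed
  moreover have "jet_operator k b (norm x) (c * \<beta>) (c * \<gamma>) \<le> c * (-1 + \<delta>)"
    unfolding jet_operator_scale[OF c] by (intro mult_left_mono j(1) c)
  ultimately show ?thesis by blast
qed

lemma lower_jet_radial:
  fixes U :: "real^'n \<Rightarrow> real"
  assumes U: "\<And>y. norm y < \<sigma> \<Longrightarrow> U y = c * (C - I (norm y))" and \<sigma>: "\<sigma> \<le> \<rho>"
    and c: "0 \<le> c" and x: "norm x < \<sigma>" and \<delta>: "0 < \<delta>"
  shows "\<exists>\<beta> \<gamma>. jet_operator k b (norm x) \<beta> \<gamma> \<ge> c * (-1 - \<delta>) \<and>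
    (\<forall>\<^sub>F y in nhds x. U y \<ge> radial_quartic (U x) \<beta> \<gamma> (x \<bullet> x) y)"
proof -
  obtain \<beta> \<gamma> d where j: "jet_operator k b (norm x) \<beta> \<gamma> \<ge> -1 - \<delta>" "d > 0"
    "\<And>s. 0 \<le> s \<Longrightarrow> s < \<rho> \<Longrightarrow> \<bar>s - norm x\<bar> < d \<Longrightarrow>
      - I (norm x) + \<beta> * (s\<^sup>2 - (norm x)\<^sup>2) + \<gamma> * (s\<^sup>2 - (norm x)\<^sup>2)\<^sup>2 \<le> - I s"
    using lower_jet[OF norm_ge_zero order_less_le_trans[OF x \<sigma>] \<delta>] by blast
  have near: "\<forall>\<^sub>F y in nhds x. dist y x < min d (\<sigma> - norm x)"
    using j(2) x unfolding eventually_nhds_metric by (intro exI[of _ "min d (\<sigma> - norm x)"]) auto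
  have "\<forall>\<^sub>F y in nhds x. U y \<ge> radial_quartic (U x) (c * \<beta>) (c * \<gamma>) (x \<bullet> x) y"
    using near
  proof eventually_elim
    case (elim y)
    have a: "\<bar>norm y - norm x\<bar> \<le> dist y x" by (simp add: dist_norm norm_triangle_ineq3)
    have y: "norm y < \<sigma>" "\<bar>norm y - norm x\<bar> < d" using a elim by auto
    have "c * (- I (norm x) + \<beta> * ((norm y)\<^sup>2 - (norm x)\<^sup>2) + \<gamma> * ((norm y)\<^sup>2 - (norm x)\<^sup>2)\<^sup>2) \<le> c * (- I (norm y))"
      by (intro mult_left_mono j(3) c) (use y \<sigma> in auto)
    then show ?case
      unfolding U[OF y(1)] U[OF x] radial_quartic_def dot_square_norm by (simp add: algebra_simps)
  qed
  moreover have "jet_operator k b (norm x) (c * \<beta>) (c * \<gamma>) \<ge> c * (-1 - \<delta>)"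
    unfolding jet_operator_scale[OF c] by (intro mult_left_mono j(1) c)
  ultimately show ?thesis by blast
qed

lemma strict_upper_jet_radial:
  fixes U :: "real^'n \<Rightarrow> real"
  assumes U: "\<And>y. norm y < \<sigma> \<Longrightarrow> U y = c * (C - I (norm y))" and \<sigma>: "\<sigma> \<le> \<rho>"
    and c: "1 < c" and x: "norm x < \<sigma>"
  shows "\<exists>\<beta> \<gamma>. jet_operator k b (norm x) \<beta> \<gamma> < -1 \<and>
    (\<forall>\<^sub>F y in nhds x. U y \<le> radial_quartic (U x) \<beta> \<gamma> (x \<bullet> x) y)"
proof -
  \<comment> \<open>With this \<open>\<delta>\<close> the bound \<open>c * (-1 + \<delta>)\<close>
    equals \<open>- (c + 1) / 2\<close>, halfway between \<open>- c\<close> and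
    \<open>-1\<close>.\<close>
  have \<delta>: "0 < (c - 1) / (2 * c)" using c by simp
  have "c * (-1 + (c - 1) / (2 * c)) < -1" using c by (simp add: field_simps)
  then show ?thesis
    using upper_jet_radial[OF U \<sigma> _ x \<delta>] c by force
qed

lemma strict_lower_jet_radial:
  fixes U :: "real^'n \<Rightarrow> real"
  assumes U: "\<And>y. norm y < \<sigma> \<Longrightarrow> U y = c * (C - I (norm y))" and \<sigma>: "\<sigma> \<le> \<rho>"
    and c: "0 < c" "c < 1" and x: "norm x < \<sigma>"
  shows "\<exists>\<beta> \<gamma>. jet_operator k b (norm x) \<beta> \<gamma> > -1 \<and>
    (\<forall>\<^sub>F y in nhds x. U y \<ge> radial_quartic (U x) \<beta> \<gamma> (x \<bullet> x) y)"
proof -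
  have \<delta>: "0 < (1 - c) / (2 * c)" using c by simp
  have "-1 < c * (-1 - (1 - c) / (2 * c))" using c by (simp add: field_simps)
  then show ?thesis
    using lower_jet_radial[OF U \<sigma> _ x \<delta>] c by force
qed

text \<open>The zero function is a strict subsolution because the operator vanishes on it. This
  transfers the boundary sign of \<open>u\<close> to the smaller spheres used next.\<close>

lemma supersolution_nonneg:
  fixes u :: "real^'n \<Rightarrow> real"
  assumes kn: "k < CARD('n)" and u: "dirichlet_supersolution k b \<rho> u" and x: "norm x \<le> \<rho>"
  shows "0 \<le> u x"
proof -
  have jet: "jet_operator k b r 0 0 > -1" for r by (simp add: jet_operator_def)
  have "(\<lambda>_. 0) x \<le> u x"
    by (rule strict_subsolution_le_visc_supersolution[where U = "\<lambda>_. 0" and \<rho> = \<rho> and \<rho>' = \<rho> and k = k and b = b])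
      (use u kn k \<rho> x jet in \<open>auto simp: dirichlet_supersolution_def radial_quartic_def intro!: exI[of _ 0]\<close>)
  then show ?thesis by simp
qed

lemma continuous_on_I_norm:
  fixes S :: "(real^'n) set"
  assumes "\<And>x. x \<in> S \<Longrightarrow> norm x < \<rho>"
  shows "continuous_on S (\<lambda>x. I (norm x))"
  by (rule continuous_on_compose2[OF continuous_on_I]) (use assms in \<open>auto intro!: continuous_intros\<close>)

text \<open>The barrier \<open>U\<close> vanishes on the sphere of radius \<open>r\<close>, where
  \<open>u\<close> is nonnegative. The fixed factor \<open>1/2\<close> makes it strict and still
  suffices, since \<open>r\<close> is chosen with \<open>I r > 2 * u 0\<close>, which gives
  \<open>U 0 > u 0\<close>.\<close>

lemma no_supersolution:
  fixes u :: "real^'n \<Rightarrow> real"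
  assumes kn: "k < CARD('n)" and unb: "\<And>C. \<exists>r. 0 < r \<and> r < \<rho> \<and> C < I r"
  shows "\<not> dirichlet_supersolution k b \<rho> u"
proof
  assume u: "dirichlet_supersolution k b \<rho> u"
  obtain r where r: "0 < r" "r < \<rho>" "2 * u 0 < I r" using unb by blast
  define U :: "real^'n \<Rightarrow> real" where "U x = (1/2) * (I r - I (norm x))" for x
  have "U 0 \<le> u 0"
  proof (rule strict_subsolution_le_visc_supersolution[where \<rho> = r and \<rho>' = \<rho> and k = k and b = b])
    show "lsc_on (cball 0 r) u"
      using u r by (auto simp: dirichlet_supersolution_def elim!: lsc_on_subset)
    show "continuous_on (cball 0 r) U"
      unfolding U_def by (intro continuous_intros continuous_on_I_norm) (use r in auto)
    show "\<exists>\<beta> \<gamma>. - 1 < jet_operator k b (norm x) \<beta> \<gamma> \<and> (\<forall>\<^sub>F y in nhds x. radial_quartic (U x) \<beta> \<gamma> (x \<bullet> x) y \<le> U y)"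
      if "x \<in> ball 0 r" for x
      by (rule strict_lower_jet_radial[of r U "1/2" "I r"]) (use that r in \<open>auto simp: U_def\<close>)
    show "U x \<le> u x" if "x \<in> sphere 0 r" for x
      using supersolution_nonneg[OF kn u, of x] that r by (auto simp: U_def)
  qed (use u r k kn in \<open>auto simp: dirichlet_supersolution_def\<close>)
  moreover have "I 0 = 0" by (simp add: I_def)
  ultimately show False using r(3) by (simp add: U_def)
qed

lemma unique_radial_solution:
  assumes kn: "k < CARD('n::finite)" and \<rho>R: "\<rho> = R" and bdd: "\<And>r. 0 \<le> r \<Longrightarrow> r < R \<Longrightarrow> I r \<le> C"
  shows "\<exists>u :: real^'n \<Rightarrow> real. dirichlet_solution k b R u \<and> radial_on (cball 0 R) u \<and>
    (\<forall>v. dirichlet_solution k b R v \<longrightarrow> (\<forall>x\<in>cball 0 R. v x = u x))"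
proof -
  \<comment> \<open>\<open>I\<close> is monotone and bounded, so \<open>L\<close> is its limit at
    \<open>R\<close> and \<open>L - I\<close> tends to 0 at the boundary, even though
    \<open>w\<close> itself may blow up there.\<close>
  define L where "L = (SUP r\<in>{0..<R}. I r)"
  have bdd': "bdd_above (I ` {0..<R})" by (intro bdd_aboveI[of _ C]) (use bdd in auto)
  have IL: "I r \<le> L" if "0 \<le> r" "r < R" for r
    unfolding L_def by (rule cSUP_upper[OF _ bdd']) (use that in auto)
  have approx: "\<exists>r. 0 \<le> r \<and> r < R \<and> L - e < I r" if "0 < e" for e
  proof -
    have "L - e < L" using that by simp
    then show ?thesis
      unfolding L_def using less_cSUP_iff[OF _ bdd', of "L - e"] \<rho> \<rho>R by (force simp: L_def)
  qed
  define u :: "real^'n \<Rightarrow> real" where "u x = (if norm x < R then L - I (norm x) else 0)" for x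
  have u: "u y = 1 * (L - I (norm y))" if "norm y < R" for y using that by (simp add: u_def)
  have cont_ball: "continuous_on (ball 0 R) u"
    by (rule continuous_on_eq[of _ "\<lambda>x. L - I (norm x)"])
      (auto intro!: continuous_intros continuous_on_I_norm simp: u_def \<rho>R)
  have cont: "continuous_on (cball 0 R) u"
    unfolding continuous_on_def
  proof
    fix x :: "real^'n" assume x: "x \<in> cball 0 R"
    show "(u \<longlongrightarrow> u x) (at x within cball 0 R)"
    proof (cases "norm x < R")
      case True
      then have "isCont u x"
        using cont_ball continuous_on_eq_continuous_at[of "ball 0 R" u] by simp
      then have "continuous (at x within cball 0 R) u" by (rule continuous_at_imp_continuous_at_within)
      then show ?thesis by (simp add: continuous_within)
    next
      case False
      then have nx: "norm x = R" using x by simp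
      show ?thesis
      proof (rule tendstoI)
        fix e :: real assume e: "0 < e"
        obtain r where r: "0 \<le> r" "r < R" "L - e < I r" using approx[OF e] by blast
        have "\<forall>\<^sub>F y in at x within cball 0 R. r < norm y"
          by (rule order_tendstoD(1)[OF tendsto_norm[OF tendsto_ident_at]]) (use r nx in simp)
        moreover have "\<forall>\<^sub>F y in at x within cball 0 R. y \<in> cball 0 R"
          by (auto simp: eventually_at_filter)
        ultimately show "\<forall>\<^sub>F y in at x within cball 0 R. dist (u y) (u x) < e"
        proof eventually_elim
          case (elim y)
          then show ?case
            using IL[of "norm y"] I_mono[of r "norm y"] r e nx \<rho>R by (auto simp: u_def dist_real_def)
        qed
      qed
    qed
  qed
  have sub: "ball 0 R \<subseteq> cball (0 :: real^'n) R" by auto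
  have "visc_subsolution k b (ball 0 R) u"
  proof (rule visc_subsolution_if_jets[OF k kn continuous_on_imp_usc_on[OF cont_ball]])
    fix x :: "real^'n" and \<delta> :: real assume "x \<in> ball 0 R" "0 < \<delta>"
    then show "\<exists>\<beta> \<gamma>. - 1 - \<delta> \<le> jet_operator k b (norm x) \<beta> \<gamma> \<and> (\<forall>\<^sub>F y in nhds x. radial_quartic (u x) \<beta> \<gamma> (x \<bullet> x) y \<le> u y)"
      using lower_jet_radial[OF u, of R x \<delta>] \<rho>R by simp
  qed
  moreover have "visc_supersolution k b (ball 0 R) u"
  proof (rule visc_supersolution_if_jets[OF less_imp_le[OF kn] continuous_on_imp_lsc_on[OF cont_ball]])
    fix x :: "real^'n" and \<delta> :: real assume "x \<in> ball 0 R" "0 < \<delta>"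
    then show "\<exists>\<beta> \<gamma>. jet_operator k b (norm x) \<beta> \<gamma> \<le> - 1 + \<delta> \<and> (\<forall>\<^sub>F y in nhds x. u y \<le> radial_quartic (u x) \<beta> \<gamma> (x \<bullet> x) y)"
      using upper_jet_radial[OF u, of R x \<delta>] \<rho>R by simp
  qed
  ultimately have sol: "dirichlet_solution k b R u"
    unfolding dirichlet_solution_def using cont by (auto simp: u_def)
  have rad: "radial_on (cball 0 R) u"
    unfolding radial_on_def by (rule exI[of _ "\<lambda>r. if r < R then L - I r else 0"]) (simp add: u_def)
  have uniq: "v x = u x" if v: "dirichlet_solution k b R v" and x: "x \<in> cball 0 R" for v x
  proof -
    have R: "0 < R" using \<rho> by simp
    have le: "v x \<le> c * u x" if c: "1 < c" for c
    proof (rule visc_subsolution_le_strict_supersolution[where \<rho> = R and k = k and b = b and U = "\<lambda>x. c * u x"])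
      show "continuous_on (cball 0 R) (\<lambda>x. c * u x)" by (intro continuous_intros cont)
      show "\<exists>\<beta> \<gamma>. jet_operator k b (norm x) \<beta> \<gamma> < - 1 \<and> (\<forall>\<^sub>F y in nhds x. c * u y \<le> radial_quartic (c * u x) \<beta> \<gamma> (x \<bullet> x) y)"
        if "x \<in> ball 0 R" for x
        by (rule strict_upper_jet_radial[of R "\<lambda>x. c * u x" c L]) (use that c u \<rho>R in auto)
    qed (use v x R kn in \<open>auto simp: dirichlet_solution_def u_def\<close>)
    have ge: "c * u x \<le> v x" if c: "0 < c" "c < 1" for c
    proof (rule strict_subsolution_le_visc_supersolution[where \<rho> = R and \<rho>' = R and k = k and b = b and U = "\<lambda>x. c * u x"])
      show "continuous_on (cball 0 R) (\<lambda>x. c * u x)" by (intro continuous_intros cont)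
      show "lsc_on (cball 0 R) v" using v continuous_on_imp_lsc_on by (auto simp: dirichlet_solution_def)
      show "\<exists>\<beta> \<gamma>. - 1 < jet_operator k b (norm x) \<beta> \<gamma> \<and> (\<forall>\<^sub>F y in nhds x. radial_quartic (c * u x) \<beta> \<gamma> (x \<bullet> x) y \<le> c * u y)"
        if "x \<in> ball 0 R" for x
        by (rule strict_lower_jet_radial[of R "\<lambda>x. c * u x" c L]) (use that c u \<rho>R in auto)
    qed (use v x R k kn in \<open>auto simp: dirichlet_solution_def u_def\<close>)
    have u0: "0 \<le> u x" using IL[of "norm x"] by (simp add: u_def)
    have "v x \<le> u x + e" if "0 < e" for e
    proof -
      \<comment> \<open>The factor is adapted to \<open>x\<close> so that the excess over
        \<open>u x\<close> is \<open>e * (u x / (u x + 1))\<close>, at most \<open>e\<close>; the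
        added 1 keeps the denominator positive where \<open>u\<close> vanishes.\<close>
      have "v x \<le> (1 + e / (u x + 1)) * u x" using le[of "1 + e / (u x + 1)"] u0 that by simp
      also have "\<dots> = u x + e * (u x / (u x + 1))" by (simp add: algebra_simps)
      also have "\<dots> \<le> u x + e" using mult_left_le[of "u x / (u x + 1)" e] u0 that by simp
      finally show ?thesis .
    qed
    moreover have "u x \<le> v x + e" if "0 < e" for e
    proof -
      define c where "c = (u x + 1) / (u x + 1 + e)"
      have c: "0 < c" "c < 1" unfolding c_def using u0 that by auto
      have "u x - c * u x = e * (u x / (u x + 1 + e))"
        unfolding c_def using u0 that by (simp add: field_simps)
      also have "\<dots> \<le> e" using mult_left_le[of "u x / (u x + 1 + e)" e] u0 that by simp
      finally show ?thesis using ge[OF c] by simp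
    qed
    ultimately show ?thesis by (meson field_le_epsilon order_antisym)
  qed
  show ?thesis using sol rad uniq by blast
qed

subsection \<open>The integral condition\<close>

text \<open>The endpoint integral truncated at \<open>r\<close>, as a real number: in this form it
  can be differentiated and its growth compared with that of \<open>I\<close>.\<close>

definition G where "G c r = integral {c..r} (\<lambda>s. s * g s)"

lemma continuous_on_sg: "0 \<le> c \<Longrightarrow> d < \<rho> \<Longrightarrow> continuous_on {c..d} (\<lambda>s. s * g s)"
  by (intro continuous_intros continuous_on_subset[OF continuous_on_g]) auto

lemma DERIV_G:
  assumes "0 < c" "c < r" "r < \<rho>"
  shows "(G c has_real_derivative r * g r) (at r)"
proof -
  have "((\<lambda>u. integral {c..u} (\<lambda>s. s * g s)) has_real_derivative r * g r) (at r within {c..(r + \<rho>) / 2})"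
    by (rule integral_has_real_derivative[of c "(r + \<rho>) / 2" "\<lambda>s. s * g s"])
      (use assms continuous_on_sg in auto)
  moreover have "at r within {c..(r + \<rho>) / 2} = at r"
    by (rule at_within_Icc_at) (use assms in auto)
  ultimately show ?thesis unfolding G_def by simp
qed

lemma continuous_on_G:
  assumes "0 < c" "d < \<rho>"
  shows "continuous_on {c..d} (G c)"
  unfolding G_def
  by (rule indefinite_integral_continuous_1, rule integrable_continuous_real)
    (use assms continuous_on_sg in auto)

lemma G_nonneg: "0 < c \<Longrightarrow> r < \<rho> \<Longrightarrow> 0 \<le> G c r"
  unfolding G_def
  by (intro integral_nonneg integrable_continuous_real continuous_on_sg)
    (auto intro!: mult_nonneg_nonneg less_imp_le[OF g_pos])

lemma endpoint_integral_eq_G: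
  assumes "0 < c" "c < r" "r < \<rho>"
  shows "endpoint_integral k b c r = ennreal (G c r)"
  unfolding endpoint_integral_def
proof (rule nn_integral_has_integral_lebesgue')
  have "((\<lambda>s. s * g s) has_integral G c r) {c..r}"
    unfolding G_def by (intro integrable_integral integrable_continuous_real continuous_on_sg) (use assms in auto)
  then show "((\<lambda>s. s / (real k - s * b s)) has_integral G c r) {c<..<r}"
    by (simp add: has_integral_Icc_iff_Ioo g_def)
  show "0 \<le> s / (real k - s * b s)" if "s \<in> {c<..<r}" for s
    using g_pos[of s] that assms by (simp add: g_def)
qed

lemma G_le_if_endpoint_integral_le:
  assumes c: "0 < c" "c < r" "r < \<rho>" and e: "endpoint_integral k b c \<rho> \<le> ennreal e" "0 \<le> e"
  shows "G c r \<le> e"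
proof -
  have "endpoint_integral k b c r \<le> endpoint_integral k b c \<rho>"
    unfolding endpoint_integral_def
    by (intro nn_integral_mono mult_left_mono) (use c in \<open>auto simp: indicator_def\<close>)
  then have "ennreal (G c r) \<le> ennreal e"
    unfolding endpoint_integral_eq_G[OF c] using e(1) by (rule order_trans)
  then show ?thesis using e(2) by (simp add: ennreal_le_iff)
qed

text \<open>Continuity from below of the measure with density \<open>h\<close>, whose values on the
  increasing intervals \<open>A n\<close> are the truncated integrals.\<close>

lemma endpoint_integral_le:
  assumes c: "0 < c" "c < \<rho>" and C: "\<And>r. c < r \<Longrightarrow> r < \<rho> \<Longrightarrow> G c r \<le> C"
  shows "endpoint_integral k b c \<rho> \<le> ennreal C"
proof -
  define f where "f s = s / (real k - s * b s)" for s
  define h where "h s = ennreal (indicator {c<..<\<rho>} s *\<^sub>R f s)" for s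
  have "real k - s * b s \<noteq> 0" if "s \<in> {c<..<\<rho>}" for s
    using below[of s] that c by auto
  then have "continuous_on {c<..<\<rho>} f"
    unfolding f_def
    by (intro continuous_intros continuous_on_subset[OF cont_b]) (use c \<rho> in auto)
  then have "(\<lambda>s. indicator {c<..<\<rho>} s *\<^sub>R f s) \<in> borel_measurable borel"
    by (rule borel_measurable_continuous_on_indicator[rotated]) simp
  then have "h \<in> borel_measurable borel"
    unfolding h_def by (rule measurable_compose[OF _ measurable_ennreal])
  then have h: "h \<in> borel_measurable lborel" by simp
  \<comment> \<open>The shift by 2 puts even \<open>r 0\<close> strictly to the right of
    \<open>c\<close>; a shift by 1 would give \<open>r 0 = c\<close>.\<close>
  define r where "r n = \<rho> - (\<rho> - c) / real (n + 2)" for n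
  define A where "A n = {c<..<r n}" for n
  have r: "c < r n" "r n < \<rho>" for n
  proof -
    have "(\<rho> - c) / real (n + 2) < (\<rho> - c) / 1"
      by (rule divide_strict_left_mono) (use c in auto)
    then show "c < r n" "r n < \<rho>" unfolding r_def using c by auto
  qed
  have r_mono: "r m \<le> r n" if "m \<le> n" for m n
    unfolding r_def using c that by (auto intro!: divide_left_mono)
  have inc: "incseq A"
    unfolding A_def incseq_def by (auto dest: r_mono)
  have A: "range A \<subseteq> sets (density lborel h)" unfolding A_def by auto
  have un: "(\<Union>n. A n) = {c<..<\<rho>}"
  proof
    show "{c<..<\<rho>} \<subseteq> (\<Union>n. A n)"
    proof
      fix x assume x: "x \<in> {c<..<\<rho>}"
      obtain n where n: "(\<rho> - c) / (\<rho> - x) < real n" using reals_Archimedean2 by blast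
      have "\<rho> - c < real (n + 2) * (\<rho> - x)"
        using n x by (simp add: divide_less_eq algebra_simps)
      then have "(\<rho> - c) / real (n + 2) < \<rho> - x"
        by (simp add: divide_less_eq mult.commute)
      then have "x < r n" unfolding r_def by simp
      then show "x \<in> (\<Union>n. A n)" using x unfolding A_def by auto
    qed
    show "(\<Union>n. A n) \<subseteq> {c<..<\<rho>}"
      unfolding A_def by (auto intro: order_less_trans[OF _ r(2)])
  qed
  have em: "emeasure (density lborel h) {c<..<s} = endpoint_integral k b c s" if "s \<le> \<rho>" for s
  proof -
    have "emeasure (density lborel h) {c<..<s} = (\<integral>\<^sup>+ x. h x * indicator {c<..<s} x \<partial>lborel)"
      by (rule emeasure_density[OF h]) simp
    also have "\<dots> = endpoint_integral k b c s"
      unfolding endpoint_integral_def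
      by (rule nn_integral_cong) (use that in \<open>auto simp: h_def f_def indicator_def\<close>)
    finally show ?thesis .
  qed
  have "endpoint_integral k b c \<rho> = (SUP n. emeasure (density lborel h) (A n))"
    unfolding SUP_emeasure_incseq[OF A inc] un by (rule em[symmetric]) simp
  also have "\<dots> \<le> ennreal C"
  proof (rule SUP_least)
    fix n
    have "emeasure (density lborel h) (A n) = ennreal (G c (r n))"
      unfolding A_def using em[of "r n"] r[of n] endpoint_integral_eq_G[OF c(1) r] by simp
    then show "emeasure (density lborel h) (A n) \<le> ennreal C"
      using C[OF r] by (simp add: ennreal_leI)
  qed
  finally show ?thesis .
qed

text \<open>As \<open>w \<ge> g\<close>, the difference \<open>I - G c\<close> is nondecreasing to
  the right of \<open>c\<close>, so a bound on \<open>I\<close> would bound all truncated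
  integrals.\<close>

lemma I_unbounded:
  assumes c: "0 < c" "c < \<rho>" and inf: "endpoint_integral k b c \<rho> = \<infinity>"
  shows "\<exists>r. 0 < r \<and> r < \<rho> \<and> C < I r"
proof (rule ccontr)
  assume "\<not> ?thesis"
  then have bdd: "\<And>r. 0 < r \<Longrightarrow> r < \<rho> \<Longrightarrow> I r \<le> C" by force
  have "G c r \<le> C - I c" if r: "c < r" "r < \<rho>" for r
  proof -
    have "I c - G c c \<le> I r - G c r"
    proof (rule DERIV_nonneg_imp_increasing_open[where f = "\<lambda>s. I s - G c s"])
      fix x assume x: "c < x" "x < r"
      have "((\<lambda>s. I s - G c s) has_real_derivative x * w x - x * g x) (at x)"
        by (intro DERIV_diff DERIV_I DERIV_G) (use x r c in auto)
      moreover have "x * g x \<le> x * w x" using x c by (simp add: w_def)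
      ultimately show "\<exists>y. ((\<lambda>s. I s - G c s) has_real_derivative y) (at x) \<and> 0 \<le> y" by force
    next
      show "continuous_on {c..r} (\<lambda>s. I s - G c s)"
        by (intro continuous_intros continuous_on_G continuous_on_subset[OF continuous_on_I]) (use r c in auto)
    qed (use r in simp)
    moreover have "G c c = 0" by (simp add: G_def)
    ultimately show ?thesis using bdd[of r] r c by simp
  qed
  then have "endpoint_integral k b c \<rho> \<le> ennreal (C - I c)" by (rule endpoint_integral_le[OF c])
  then show False using inf by (simp add: top_unique)
qed

text \<open>\<open>W\<close> is bounded by some \<open>K\<close> on the compact interval
  \<open>[0, R]\<close>, so \<open>w \<le> g + K\<close>, and beyond \<open>c\<close> the growth of
  \<open>I\<close> exceeds that of \<open>G c\<close> by at most that of
  \<open>K * s\<^sup>2 / 2\<close>.\<close>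

lemma I_bounded:
  assumes c: "0 < c" "c < \<rho>" and fin: "endpoint_integral k b c \<rho> < \<infinity>"
  shows "\<exists>C. \<forall>r. 0 \<le> r \<and> r < \<rho> \<longrightarrow> I r \<le> C"
proof -
  obtain e where e: "0 \<le> e" "endpoint_integral k b c \<rho> = ennreal e"
    using fin by (cases "endpoint_integral k b c \<rho>") auto
  have "compact (W ` {0..R})" by (intro compact_continuous_image continuous_on_W) simp
  then have "bounded (W ` {0..R})" by (rule compact_imp_bounded)
  then obtain K where "\<forall>x\<in>W ` {0..R}. norm x \<le> K" unfolding bounded_iff by blast
  then have K: "\<And>s. 0 \<le> s \<Longrightarrow> s \<le> R \<Longrightarrow> \<bar>W s\<bar> \<le> K" by auto
  have "I r \<le> I c + e + K * R\<^sup>2 / 2" if r: "0 \<le> r" "r < \<rho>" for r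
  proof (cases "r \<le> c")
    case True
    have "0 \<le> K" using K[of 0] \<rho> by simp
    then show ?thesis using I_mono[OF r(1) True c(2)] e by (simp add: add_increasing2)
  next
    case False
    then have r: "c < r" "r < \<rho>" using r by auto
    have K0: "0 \<le> K" using K[of 0] \<rho> by simp
    let ?F = "\<lambda>s. I s - G c s - K * s\<^sup>2 / 2"
    have "?F r \<le> ?F c"
    proof (rule DERIV_nonpos_imp_decreasing_open[where f = ?F])
      fix x assume x: "c < x" "x < r"
      have "(?F has_real_derivative x * w x - x * g x - K * x) (at x)"
        using DERIV_I[of x] DERIV_G[of c x] x r c
        by (auto intro!: derivative_eq_intros)
      moreover have "w x \<le> g x + K"
        using K[of x] g_pos[of x] x r c \<rho> K0 by (auto simp: w_def)
      then have "x * w x \<le> x * (g x + K)" using x c by (intro mult_left_mono) auto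
      then have "x * w x - x * g x - K * x \<le> 0" by (simp add: algebra_simps)
      ultimately show "\<exists>y. (?F has_real_derivative y) (at x) \<and> y \<le> 0" by blast
    next
      show "continuous_on {c..r} ?F"
        by (intro continuous_intros continuous_on_G continuous_on_subset[OF continuous_on_I]) (use r c in auto)
    qed (use r in simp)
    moreover have "G c c = 0" by (simp add: G_def)
    moreover have "G c r \<le> e" by (rule G_le_if_endpoint_integral_le[OF c(1) r]) (use e in auto)
    moreover have "K * r\<^sup>2 / 2 \<le> K * R\<^sup>2 / 2"
      using r c \<rho> K0 by (intro divide_right_mono mult_left_mono power_mono) auto
    moreover have "0 \<le> K * c\<^sup>2 / 2" using K0 by simp
    ultimately show ?thesis by simp
  qed
  then show ?thesis by blast
qed

text \<open>At an interior zero of \<open>k - r b(r)\<close> the integrand has at least a simple pole.\<close>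

lemma endpoint_integral_infinite_if_interior:
  assumes c: "0 < c" "c < \<rho>" and int: "\<rho> < R" and zero: "\<rho> * b \<rho> = real k"
  shows "endpoint_integral k b c \<rho> = \<infinity>"
proof (rule ccontr)
  assume "endpoint_integral k b c \<rho> \<noteq> \<infinity>"
  then obtain e where e: "0 \<le> e" "endpoint_integral k b c \<rho> = ennreal e"
    by (cases "endpoint_integral k b c \<rho>") auto
  define p where "p = deriv (\<lambda>s. s * b s) \<rho>"
  \<comment> \<open>Exceeds the slope \<open>p\<close> of \<open>r * b r\<close> at
    \<open>\<rho>\<close>, so that \<open>k - r * b r < K * (\<rho> - r)\<close> just to the left of
    \<open>\<rho>\<close>.\<close>
  define K where "K = \<bar>p\<bar> + 1"
  have K: "0 < K" "p < K" unfolding K_def by auto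
  have "((\<lambda>s. s * b s - K * s) has_real_derivative p - K) (at \<rho>)"
    unfolding p_def by (rule DERIV_diff[OF DERIV_rb DERIV_cmult_Id]) (use \<rho> int in auto)
  from DERIV_neg_dec_left[OF this] K obtain d where d: "0 < d"
    "\<And>h. 0 < h \<Longrightarrow> h < d \<Longrightarrow> \<rho> * b \<rho> - K * \<rho> < (\<rho> - h) * b (\<rho> - h) - K * (\<rho> - h)"
    by auto
  define a where "a = (max c (\<rho> - d) + \<rho>) / 2"
  have a: "c < a" "\<rho> - d < a" "a < \<rho>" unfolding a_def using c d by auto
  \<comment> \<open>\<open>X\<close> is the increase of \<open>- ln (\<rho> - t)\<close> from
    \<open>a\<close> to the point \<open>s\<close> chosen below. Since
    \<open>t * g t \<ge> a / (K * (\<rho> - t))\<close> in between, \<open>G c\<close> grows by at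
    least \<open>a / K * X = e + 1\<close>, more than the integral allows.\<close>
  define X where "X = (e + 1) * K / a"
  have X: "0 < X" "a / K * X = e + 1" unfolding X_def using e a c K by auto
  define s where "s = \<rho> - (\<rho> - a) * exp (- X)"
  have "(\<rho> - a) * exp (- X) < (\<rho> - a) * 1" using X a by (intro mult_strict_left_mono) auto
  moreover have "0 < (\<rho> - a) * exp (- X)" using a by simp
  ultimately have s: "a < s" "s < \<rho>" unfolding s_def by simp_all
  have ln_s: "ln (\<rho> - s) = ln (\<rho> - a) - X"
    unfolding s_def using a by (simp add: ln_mult)
  let ?F = "\<lambda>t. G c t + a / K * ln (\<rho> - t)"
  have "?F a \<le> ?F s"
  proof (rule DERIV_nonneg_imp_increasing_open[where f = ?F])
    fix x assume x: "a < x" "x < s"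
    have x\<rho>: "x < \<rho>" "c < x" "0 < x" using x s a c by auto
    have "((\<lambda>t. ln (\<rho> - t)) has_real_derivative - (1 / (\<rho> - x))) (at x)"
      using x\<rho> by (auto intro!: derivative_eq_intros)
    from DERIV_add[OF DERIV_G[OF c(1) x\<rho>(2,1)] DERIV_cmult[OF this, of "a / K"]]
    have "(?F has_real_derivative x * g x - a / K / (\<rho> - x)) (at x)" by simp
    moreover have "a / K / (\<rho> - x) \<le> x * g x"
    proof -
      have "real k - x * b x < K * (\<rho> - x)"
        using d(2)[of "\<rho> - x"] x a zero x\<rho> by (simp add: algebra_simps)
      then have "1 / (K * (\<rho> - x)) \<le> g x"
        unfolding g_def using below[of x] x\<rho> by (intro divide_left_mono mult_pos_pos) (auto simp: K)
      then have "a * (1 / (K * (\<rho> - x))) \<le> x * g x"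
        using x x\<rho> a c K by (intro mult_mono) auto
      then show ?thesis by simp
    qed
    ultimately show "\<exists>y. (?F has_real_derivative y) (at x) \<and> 0 \<le> y" by (intro exI conjI) auto
  next
    show "continuous_on {a..s} ?F"
      by (intro continuous_intros continuous_on_subset[OF continuous_on_G[OF c(1) s(2)]]) (use s a in auto)
  qed (use s in simp)
  then have "G c a + a / K * X \<le> G c s" unfolding ln_s by (simp add: algebra_simps)
  moreover have "G c s \<le> e" by (rule G_le_if_endpoint_integral_le[OF c(1)]) (use s a e in auto)
  moreover have "0 \<le> G c a" using G_nonneg[OF c(1) a(3)] .
  ultimately show False using X by simp
qed

end


subsection \<open>The critical radius\<close>

text \<open>\<open>r * b r\<close> vanishes at 0, so by the intermediate value theorem it takes the
  value \<open>k\<close> no later than it reaches or exceeds \<open>k\<close>. Hence the infimum in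
  \<open>critical_radius\<close> is over a nonempty set, and before it \<open>r * b r\<close> stays
  below \<open>k\<close>.\<close>

lemma critical_radius_properties:
  assumes k: "1 \<le> k" and R: "0 < R" and cont: "continuous_on {0..R} b"
    and \<rho>: "\<rho> = critical_radius k b R"
  shows "\<rho> \<le> R" "\<rho> < R \<Longrightarrow> \<rho> * b \<rho> = real k"
    "\<And>r. 0 \<le> r \<Longrightarrow> r < \<rho> \<Longrightarrow> r * b r < real k"
proof -
  define q where "q r = r * b r" for r
  define S where "S = {r \<in> {0<..<R}. q r = real k}"
  have cq: "continuous_on {0..R} q" unfolding q_def by (intro continuous_intros cont)
  have ivt: "\<exists>x\<in>S. x \<le> r" if "0 < r" "r < R" "real k \<le> q r" for r
  proof -
    have "\<exists>x\<ge>0. x \<le> r \<and> q x = real k"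
      by (rule IVT') (use that k continuous_on_subset[OF cq] in \<open>auto simp: q_def\<close>)
    then obtain x where x: "0 \<le> x" "x \<le> r" "q x = real k" by blast
    then have "x \<noteq> 0" using k by (auto simp: q_def)
    then show ?thesis using x that unfolding S_def by (intro bexI[of _ x]) auto
  qed
  have bdd: "bdd_below S" unfolding S_def by (auto intro!: bdd_belowI[of _ 0])
  have "(\<rho> = R \<and> (\<forall>r\<in>{0<..<R}. q r < real k)) \<or> (S \<noteq> {} \<and> \<rho> = Inf S)"
  proof (cases "\<forall>r\<in>{0<..<R}. q r < real k")
    case True
    then show ?thesis unfolding \<rho> critical_radius_def q_def by simp
  next
    case False
    then have "S \<noteq> {}" using ivt by force
    moreover have "\<rho> = Inf S"
      using False unfolding \<rho> critical_radius_def S_def q_def by auto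
    ultimately show ?thesis by blast
  qed
  then have "\<rho> \<le> R \<and> (\<rho> < R \<longrightarrow> q \<rho> = real k) \<and> (\<forall>r. 0 \<le> r \<and> r < \<rho> \<longrightarrow> q r < real k)"
  proof (elim disjE conjE)
    assume "\<rho> = R" "\<forall>r\<in>{0<..<R}. q r < real k"
    then show ?thesis using k by (auto simp: q_def order.order_iff_strict)
  next
    assume S: "S \<noteq> {}" and \<rho>S: "\<rho> = Inf S"
    then obtain s where s: "s \<in> S" by blast
    have "\<rho> \<le> s" unfolding \<rho>S by (rule cInf_lower[OF s bdd])
    then have \<rho>R: "\<rho> < R" using s unfolding S_def by auto
    \<comment> \<open>\<open>S\<close> is a subset of the open interval, so closedness is argued in
      \<open>[0, R]\<close>; it gives the value \<open>k\<close> at the infimum itself.\<close>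
    have "closed {r \<in> {0..R}. q r = real k}"
      by (rule continuous_closed_preimage_constant[OF cq]) simp
    moreover have "S \<subseteq> {r \<in> {0..R}. q r = real k}" unfolding S_def by auto
    ultimately have "closure S \<subseteq> {r \<in> {0..R}. q r = real k}" by (rule closure_minimal[rotated])
    then have "q \<rho> = real k" using closure_contains_Inf[OF S bdd] \<rho>S by auto
    moreover have "q r < real k" if "0 \<le> r" "r < \<rho>" for r
    proof (rule ccontr)
      assume neg: "\<not> q r < real k"
      then have "r \<noteq> 0" using k by (auto simp: q_def)
      then have "0 < r" "r < R" "real k \<le> q r" using neg that \<rho>R by auto
      from ivt[OF this] obtain x where "x \<in> S" "x \<le> r" by blast
      then show False using cInf_lower[OF _ bdd, of x] that \<rho>S by simp
    qed
    ultimately show ?thesis using \<rho>R by auto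
  qed
  then show "\<rho> \<le> R" "\<rho> < R \<Longrightarrow> \<rho> * b \<rho> = real k"
    "\<And>r. 0 \<le> r \<Longrightarrow> r < \<rho> \<Longrightarrow> r * b r < real k"
    by (auto simp: q_def)
qed

theorem proposition22:
  fixes k :: nat and R r0 c R0 :: real and b :: "real \<Rightarrow> real"
  assumes "1 \<le> k" and "k < CARD('n::finite)"
    and "0 < R"
    and "continuous_on {0..R} b" and "b C1_differentiable_on {0<..<R}"
    and "r0 \<in> {0..R}"
    and "\<forall>r\<in>{0<..<R}. (r - r0) * deriv (\<lambda>s. s * b s) r \<ge> 0"
    and "R0 = critical_radius k b R"
    and "c \<in> {0<..<R0}"
  shows "(endpoint_integral k b c R0 < \<infinity> \<longrightarrow>
            R0 = R \<and>
            (\<exists>u :: real^'n \<Rightarrow> real. dirichlet_solution k b R u \<and> radial_on (cball 0 R) u \<and>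
               (\<forall>v. dirichlet_solution k b R v \<longrightarrow> (\<forall>x\<in>cball 0 R. v x = u x)))) \<and>
         (endpoint_integral k b c R0 = \<infinity> \<longrightarrow>
            \<not> (\<exists>u :: real^'n \<Rightarrow> real. dirichlet_supersolution k b R0 u))"
proof -
  have k1: "1 \<le> k" and kn: "k < CARD('n)" and R: "0 < R" and cont: "continuous_on {0..R} b"
    and r0: "0 \<le> r0" and R0: "R0 = critical_radius k b R" and c: "0 < c" "c < R0"
    using assms by auto
  note cr = critical_radius_properties[OF k1 R cont R0]
  have diff: "b differentiable (at r)" if "0 < r" "r < R" for r
    using C1_diff_imp_diff[OF assms(5)] that by (simp add: differentiable_on_eq_differentiable_at)
  interpret radial_drift k b r0 R0 R
    by unfold_locales (use k1 c cr r0 cont diff assms(7) in auto)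
  show ?thesis
  proof (intro conjI[OF impI impI])
    assume fin: "endpoint_integral k b c R0 < \<infinity>"
    \<comment> \<open>If \<open>R0 < R\<close>, then \<open>R0 * b R0 = k\<close> at an interior
      point, and the pole there makes the integral infinite.\<close>
    then have eq: "R0 = R"
      using endpoint_integral_infinite_if_interior[OF c] cr(1,2) by force
    obtain C where "\<forall>r. 0 \<le> r \<and> r < R0 \<longrightarrow> I r \<le> C" using I_bounded[OF c fin] by blast
    then have "I r \<le> C" if "0 \<le> r" "r < R" for r using that eq by simp
    from unique_radial_solution[OF kn eq this]
    show "R0 = R \<and> (\<exists>u :: real^'n \<Rightarrow> real. dirichlet_solution k b R u \<and> radial_on (cball 0 R) u \<and>
               (\<forall>v. dirichlet_solution k b R v \<longrightarrow> (\<forall>x\<in>cball 0 R. v x = u x)))"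
      using eq by blast
  next
    assume "endpoint_integral k b c R0 = \<infinity>"
    then show "\<not> (\<exists>u :: real^'n \<Rightarrow> real. dirichlet_supersolution k b R0 u)"
      using no_supersolution[OF kn I_unbounded[OF c]] by blast
  qed
qed

end
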